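(* Let $\mathbb{K}$ be a field with characteristic different from $2$, let $\alpha \in \mathbb{K}\setminus\{0\}$, let $E$ be a vector space over $\mathbb{K}$ of finite dimension $n \geq 1$, and let $u\in\operatorname{End}(E)$. Then $u$ is an $(\alpha,\alpha)$-composite (in $\operatorname{End}(E)$) if and only if both of the following conditions hold: (i) The sequences $(n_k(u,0))_{k \geq 1}$ and $(n_k(u,2\alpha))_{k \geq 1}$ are intertwined. (ii) The elementary factors of $u_{-\{0,\alpha,2\alpha\}}$ are polynomials of $(X-\alpha)^2$.
   Context: For scalars $a,b \in \mathbb{K}\setminus\{0\}$, an element $x$ of a $\mathbb{K}$-algebra $\mathcal{A}$ is an $(a,b)$-composite if there are idempotents $p,q \in \mathcal{A}$ (i.e. $p^2=p$, $q^2=q$) with $x = a p + b q$. For $u\in\operatorname{End}(E)$, $\lambda\in\mathbb{K}$ and an integer $k\geq 1$, $n_k(u,\lambda) := \dim \operatorname{Ker}(u-\lambda\,\mathrm{id}_E)^k - \dim\operatorname{Ker}(u-\lambda\,\mathrm{id}_E)^{k-1}$. Two sequences $(u_k)_{k\geq 1}$ and $(v_k)_{k\geq 1}$ are intertwined if for all $k \geq 1$: $v_{k+1} \leq u_k$ and $u_{k+1} \leq v_k$. For a subset $\Lambda\subset\mathbb{K}$, write the minimal polynomial of $u$ as $\mu_u = P Q$ with $P$ a product of (possibly repeated) factors $X-\lambda$, $\lambda\in\Lambda$, and $Q$ monic with no root in $\Lambda$; then $u_{-\Lambda}$ denotes the endomorphism of $\operatorname{Ker} Q(u)$ induced by $u$.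 The elementary factors of an endomorphism (or square matrix) are its invariant factors: the nonconstant monic polynomials $P_1 \mid P_2 \mid \dots \mid P_N$ in $\mathbb{K}[X]$ such that it is represented by (similar to) the block-diagonal matrix of the companion matrices of $P_1,\dots,P_N$ (there are none if the space is zero). A polynomial of $R$ (with $R\in\mathbb{K}[X]$) is a polynomial of the form $S(R)$ with $S\in\mathbb{K}[X]$. *)

theory Defs
  imports
    "HOL-Computational_Algebra.Polynomial"
    "Jordan_Normal_Form.Matrix"
begin

definition intertwined :: "(nat \<Rightarrow> int) \<Rightarrow> (nat \<Rightarrow> int) \<Rightarrow> bool" where
  "intertwined u v \<longleftrightarrow> (\<forall>k\<ge>1. v (k + 1) \<le> u k \<and> u (k + 1) \<le> v k)"

definition polynomial_of :: "'a::field poly \<Rightarrow> 'a poly \<Rightarrow> bool" where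
  "polynomial_of R P \<longleftrightarrow> (\<exists>S. P = pcompose S R)"

text \<open>Only meant for a nonconstant monic polynomial \<open>P\<close>: ones on the subdiagonal, and the
  negated lower coefficients of \<open>P\<close> in the last column.\<close>

definition companion_mat :: "'a::field poly \<Rightarrow> 'a mat" where
  "companion_mat P = mat (degree P) (degree P) (\<lambda>(i, j).
     if j + 1 = degree P then - coeff P i else if i = j + 1 then 1 else 0)"

text \<open>The monic divisor \<open>Q\<close> of \<open>\<mu>\<close> without root in \<open>\<Lambda>\<close> such that \<open>\<mu> = P * Q\<close> with \<open>P\<close> a product
  of possibly repeated factors \<open>X - c\<close>, \<open>c \<in> \<Lambda>\<close>. It is unique if \<open>\<mu>\<close> is monic.\<close>

definition rootless_part :: "'a::field set \<Rightarrow> 'a poly \<Rightarrow> 'a poly" where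
  "rootless_part \<Lambda> \<mu> = (THE Q. lead_coeff Q = 1 \<and> (\<forall>c\<in>\<Lambda>. poly Q c \<noteq> 0) \<and>
     (\<exists>cs. set cs \<subseteq> \<Lambda> \<and> \<mu> = prod_list (map (\<lambda>c. [:- c, 1:]) cs) * Q))"

text \<open>The vector space \<open>E\<close> is the whole type \<open>'b\<close>, with scalar multiplication \<open>s\<close>;
  endomorphisms are functions satisfying \<open>Vector_Spaces.linear s s\<close>, and multiplication
  in \<open>End(E)\<close> is composition. The notion is only meant for nonzero \<open>a\<close> and \<open>b\<close>.\<close>

definition composite :: "('a::field \<Rightarrow> 'b::ab_group_add \<Rightarrow> 'b) \<Rightarrow> 'a \<Rightarrow> 'a \<Rightarrow> ('b \<Rightarrow> 'b) \<Rightarrow> bool" where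
  "composite s a b x \<longleftrightarrow> (\<exists>p q.
     Vector_Spaces.linear s s p \<and> p \<circ> p = p \<and>
     Vector_Spaces.linear s s q \<and> q \<circ> q = q \<and>
     x = (\<lambda>v. s a (p v) + s b (q v)))"

text \<open>For \<open>k \<ge> 1\<close>; the value at \<open>k = 0\<close> is irrelevant.\<close>

definition n_seq :: "('a::field \<Rightarrow> 'b::ab_group_add \<Rightarrow> 'b) \<Rightarrow> ('b \<Rightarrow> 'b) \<Rightarrow> 'a \<Rightarrow> nat \<Rightarrow> int" where
  "n_seq s u c k =
     int (vector_space.dim s {x. ((\<lambda>v. u v - s c v) ^^ k) x = 0}) -
     int (vector_space.dim s {x. ((\<lambda>v. u v - s c v) ^^ (k - 1)) x = 0})"

definition poly_endo :: "('a::field \<Rightarrow> 'b::ab_group_add \<Rightarrow> 'b) \<Rightarrow> 'a poly \<Rightarrow> ('b \<Rightarrow> 'b) \<Rightarrow> 'b \<Rightarrow> 'b" where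
  "poly_endo s P u x = (\<Sum>i\<le>degree P. s (coeff P i) ((u ^^ i) x))"

definition min_poly :: "('a::field \<Rightarrow> 'b::ab_group_add \<Rightarrow> 'b) \<Rightarrow> ('b \<Rightarrow> 'b) \<Rightarrow> 'a poly" where
  "min_poly s u = (THE \<mu>. lead_coeff \<mu> = 1 \<and>
     (\<forall>P. (\<forall>x. poly_endo s P u x = 0) \<longleftrightarrow> \<mu> dvd P))"

text \<open>The space on which the endomorphism \<open>u\<^sub>-\<^sub>\<Lambda>\<close> acts; it is stable under \<open>u\<close>, and \<open>u\<^sub>-\<^sub>\<Lambda>\<close> is the
  restriction of \<open>u\<close> to it.\<close>

definition rootless_space :: "('a::field \<Rightarrow> 'b::ab_group_add \<Rightarrow> 'b) \<Rightarrow> ('b \<Rightarrow> 'b) \<Rightarrow> 'a set \<Rightarrow> 'b set" where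
  "rootless_space s u \<Lambda> = {x. poly_endo s (rootless_part \<Lambda> (min_poly s u)) u x = 0}"

text \<open>\<open>A\<close> represents the endomorphism induced by \<open>u\<close> on the subspace \<open>W\<close>, in some ordered basis
  \<open>bs\<close> of \<open>W\<close>.\<close>

definition represented_on :: "('a::field \<Rightarrow> 'b::ab_group_add \<Rightarrow> 'b) \<Rightarrow> 'b set \<Rightarrow> ('b \<Rightarrow> 'b) \<Rightarrow> 'a mat \<Rightarrow> bool" where
  "represented_on s W u A \<longleftrightarrow> (\<exists>bs. distinct bs \<and> \<not> module.dependent s (set bs) \<and>
     module.span s (set bs) = W \<and>
     A \<in> carrier_mat (length bs) (length bs) \<and>
     (\<forall>j<length bs. u (bs ! j) = (\<Sum>i<length bs. s (A $$ (i, j)) (bs ! i))))"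

text \<open>The list \<open>P\<^sub>1 dvd \<dots> dvd P\<^sub>N\<close> of elementary factors of the endomorphism induced by \<open>u\<close> on a
  finite-dimensional stable subspace \<open>W\<close>. Existence and uniqueness of the list are the theorem on
  the rational canonical form.\<close>

definition elementary_factors :: "('a::field \<Rightarrow> 'b::ab_group_add \<Rightarrow> 'b) \<Rightarrow> 'b set \<Rightarrow> ('b \<Rightarrow> 'b) \<Rightarrow> 'a poly list" where
  "elementary_factors s W u = (THE Ps.
     (\<forall>P\<in>set Ps. lead_coeff P = 1 \<and> degree P > 0) \<and>
     sorted_wrt (dvd) Ps \<and>
     represented_on s W u (diag_block_mat (map companion_mat Ps)))"

end

theory Submission
  imports Defs
begin

text \<open>
  Write \<open>\<rho>\<close> for the substitution \<open>X \<mapsto> 2 * \<alpha> - X\<close>. The theorem rests on replacing the two idempotents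
  by one operator: if \<open>u = \<alpha> * p + \<alpha> * q\<close>, then \<open>b = \<alpha> * (p - q)\<close> satisfies
  \<open>b * u = (2 * \<alpha> - u) * b\<close> and \<open>b\<^sup>2 = u * (2 * \<alpha> - u)\<close>, and conversely such a \<open>b\<close> gives the idempotents
  \<open>(u + b) / (2 * \<alpha>)\<close> and \<open>(u - b) / (2 * \<alpha>)\<close> (lemma \<open>composite_iff\<close>). So \<open>b\<close> intertwines the action of
  a polynomial \<open>P\<close> with that of \<open>\<rho> P\<close>, and it is invertible away from the eigenvalues \<open>0\<close> and \<open>2 * \<alpha>\<close>,
  which \<open>\<rho>\<close> swaps.

  Necessity. On the rootless space \<open>b\<close> is bijective, so the kernels of \<open>R(u)\<close> and \<open>(\<rho> R)(u)\<close> in it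
  have the same dimension for all \<open>R\<close>. Since the kernel of \<open>R(u)\<close> has dimension
  \<open>\<Sum>i. deg (gcd P\<^sub>i R)\<close> where the \<open>P\<^sub>i\<close> are the invariant factors, and these numbers determine the
  \<open>P\<^sub>i\<close> (lemma \<open>divisor_chain_unique\<close>), every elementary factor there is fixed by \<open>\<rho>\<close> up to sign, and
  then fixed because it does not vanish at \<open>\<alpha>\<close>. In characteristic other than \<open>2\<close> the polynomials
  fixed by \<open>\<rho>\<close> are the polynomials of \<open>(X - \<alpha>)\<^sup>2\<close>. Between the generalized eigenspaces at \<open>0\<close> and
  \<open>2 * \<alpha>\<close>, \<open>b\<close> goes back and forth; each passage from the kernel of \<open>b ^^ (j + 1)\<close> in one to the kernel
  of \<open>b ^^ j\<close> in the other is injective on the successive quotients, and the kernel of \<open>(u - c) ^^ k\<close> is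
  that of \<open>b ^^ (2 * k)\<close>. Adding up the inequalities of dimensions gives the intertwining
  (lemma \<open>n_seq_le\<close>).

  Sufficiency. Decompose the space into cyclic summands \<open>K[X] / D\<close> with a chain of invariant factors
  \<open>D\<close>. On one summand, \<open>b f = g * \<rho> f\<close> is a solution if \<open>g * \<rho> g = X * (2 * \<alpha> - X)\<close> and
  \<open>D dvd g * \<rho> D\<close>; the candidates are \<open>g = X\<close> and \<open>g = 2 * \<alpha> - X\<close>. The second condition holds for one of
  them as soon as the part of \<open>D\<close> without the roots \<open>0\<close>, \<open>\<alpha>\<close>, \<open>2 * \<alpha>\<close> is fixed by \<open>\<rho>\<close> and the orders of
  \<open>D\<close> at \<open>0\<close> and \<open>2 * \<alpha>\<close> differ by at most one (lemma \<open>exists_twist\<close>). The first is the condition on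
  the elementary factors. The second is the intertwining, because the orders of the \<open>D\<close> at \<open>c\<close> form
  the partition conjugate to \<open>n\<^sub>k(u, c)\<close> and decrease along the chain for both eigenvalues at once, so
  that no pairing of Jordan blocks has to be chosen.

  Cyclic decompositions exist because there is a vector whose annihilator is the minimal polynomial,
  and the cyclic subspace that it generates has a stable complement
  (lemmas \<open>exists_maximal_annihilator\<close> and \<open>exists_stable_complement\<close>).
\<close>

section \<open>Divisibility of polynomials over a field\<close>

lemma poly_ideal_generator:
  fixes I :: "'a::field poly set"
  assumes add: "\<And>P Q. P \<in> I \<Longrightarrow> Q \<in> I \<Longrightarrow> P + Q \<in> I"
    and mult: "\<And>P Q. P \<in> I \<Longrightarrow> Q * P \<in> I"
    and nonzero: "P0 \<in> I" "P0 \<noteq> 0"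
  obtains D where "lead_coeff D = 1" "\<And>P. P \<in> I \<longleftrightarrow> D dvd P"
proof -
  obtain G where G: "G \<in> I" "G \<noteq> 0" and G_min: "\<And>P. P \<in> I \<Longrightarrow> P \<noteq> 0 \<Longrightarrow> degree G \<le> degree P"
    using ex_has_least_nat[of "\<lambda>P. P \<in> I \<and> P \<noteq> 0" P0 degree] nonzero by blast
  define D where "D = Polynomial.smult (inverse (lead_coeff G)) G"
  have "D \<in> I"
    using mult[OF G(1), of "[:inverse (lead_coeff G):]"] by (simp add: D_def)
  have D_min: "degree D \<le> degree P" if "P \<in> I" "P \<noteq> 0" for P
    using G_min[OF that] G(2) by (simp add: D_def)
  have "lead_coeff D = 1"
    using G(2) by (simp add: D_def)
  then have "D \<noteq> 0" by auto
  have "P \<in> I \<longleftrightarrow> D dvd P" for P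
  proof
    assume "P \<in> I"
    have "P mod D = P + (- (P div D)) * D"
      by (simp add: minus_div_mult_eq_mod[symmetric])
    then have "P mod D \<in> I"
      using add[OF \<open>P \<in> I\<close> mult[OF \<open>D \<in> I\<close>]] by metis
    then have "P mod D = 0"
      using D_min degree_mod_less[OF \<open>D \<noteq> 0\<close>, of P] by force
    then show "D dvd P" by (simp add: dvd_eq_mod_eq_0)
  next
    assume "D dvd P"
    then show "P \<in> I"
      using mult[OF \<open>D \<in> I\<close>] by (metis dvd_def mult.commute)
  qed
  with \<open>lead_coeff D = 1\<close> show thesis by (rule that)
qed

text \<open>
  The monic generator of the ideal of \<open>P\<close> and \<open>Q\<close>, or \<open>0\<close> for the zero ideal. It is characterized by
  the ideal rather than by common divisors so that Bezout's identity is part of the description.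
\<close>

definition pgcd :: "'a::field poly \<Rightarrow> 'a poly \<Rightarrow> 'a poly" where
  "pgcd P Q = (SOME D. (D = 0 \<or> lead_coeff D = 1) \<and> (\<forall>R. D dvd R \<longleftrightarrow> (\<exists>A B. R = A * P + B * Q)))"

lemma pgcd_principal:
  "(pgcd P Q = 0 \<or> lead_coeff (pgcd P Q) = 1) \<and> (\<forall>R. pgcd P Q dvd R \<longleftrightarrow> (\<exists>A B. R = A * P + B * Q))"
proof -
  have "\<exists>D. (D = 0 \<or> lead_coeff D = 1) \<and> (\<forall>R. D dvd R \<longleftrightarrow> (\<exists>A B. R = A * P + B * Q))"
  proof (cases "P = 0 \<and> Q = 0")
    case True
    then show ?thesis by (intro exI[where x = 0]) simp
  next
    case False
    define I where "I = {R. \<exists>A B. R = A * P + B * Q}"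
    have "P = 1 * P + 0 * Q" "Q = 0 * P + 1 * Q" by simp_all
    then have P: "P \<in> I" and Q: "Q \<in> I" unfolding I_def mem_Collect_eq by metis+
    obtain P0 where P0: "P0 \<in> I" "P0 \<noteq> 0" using P Q False by blast
    have add: "R + S \<in> I" if R: "R \<in> I" and S: "S \<in> I" for R S
    proof -
      obtain A B where "R = A * P + B * Q"
        using R unfolding I_def by blast
      moreover obtain C D where "S = C * P + D * Q"
        using S unfolding I_def by blast
      ultimately have "R + S = (A + C) * P + (B + D) * Q" by (simp add: algebra_simps)
      then show ?thesis unfolding I_def by blast
    qed
    have mult: "S * R \<in> I" if R: "R \<in> I" for R S
    proof -
      obtain A B where "R = A * P + B * Q"
        using R unfolding I_def by blast
      then have "S * R = (S * A) * P + (S * B) * Q" by (simp add: algebra_simps)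
      then show ?thesis unfolding I_def by blast
    qed
    obtain D where "lead_coeff D = 1" "\<And>R. R \<in> I \<longleftrightarrow> D dvd R"
      using poly_ideal_generator[OF add mult P0] by blast
    then show ?thesis
      unfolding I_def mem_Collect_eq by (intro exI[where x = D]) simp
  qed
  then show ?thesis unfolding pgcd_def by (rule someI_ex)
qed

lemma pgcd_bezout: obtains A B where "pgcd P Q = A * P + B * Q"
proof -
  have "pgcd P Q dvd pgcd P Q" by simp
  then show thesis using pgcd_principal[of P Q] that by blast
qed

lemma pgcd_dvd [simp]: "pgcd P Q dvd P" "pgcd P Q dvd Q"
proof -
  have "P = 1 * P + 0 * Q" "Q = 0 * P + 1 * Q"
    by simp_all
  then show "pgcd P Q dvd P" "pgcd P Q dvd Q"
    using pgcd_principal[of P Q] by metis+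
qed

lemma dvd_pgcd_iff: "R dvd pgcd P Q \<longleftrightarrow> R dvd P \<and> R dvd Q"
proof
  assume "R dvd pgcd P Q"
  then show "R dvd P \<and> R dvd Q" using pgcd_dvd dvd_trans by blast
next
  assume *: "R dvd P \<and> R dvd Q"
  obtain A B where "pgcd P Q = A * P + B * Q" by (rule pgcd_bezout)
  then show "R dvd pgcd P Q" using * by (simp add: dvd_add dvd_mult)
qed

lemma pgcd_eq_0_iff [simp]: "pgcd P Q = 0 \<longleftrightarrow> P = 0 \<and> Q = 0"
  using dvd_pgcd_iff[of 0 P Q] by simp

lemma pgcd_monic: "P \<noteq> 0 \<Longrightarrow> lead_coeff (pgcd P Q) = 1"
  using pgcd_principal[of P Q] by auto

lemma degree_eq_of_mutual_dvd:
  fixes P Q :: "'a::field poly"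
  assumes "P dvd Q" "Q dvd P"
  shows "degree P = degree Q"
  using assms by (metis dvd_0_left_iff dvd_imp_degree_le le_antisym)

lemma monic_dvd_antisym:
  fixes P Q :: "'a::field poly"
  assumes "lead_coeff P = 1" "lead_coeff Q = 1" "P dvd Q" "Q dvd P"
  shows "P = Q"
proof -
  obtain R where R: "Q = P * R" using assms(3) by (elim dvdE)
  have "Q \<noteq> 0" using assms(2) by auto
  then have "P \<noteq> 0" "R \<noteq> 0" using R by auto
  then have "degree R = 0"
    using degree_eq_of_mutual_dvd[OF assms(3,4)] by (simp add: R degree_mult_eq)
  moreover have "lead_coeff R = 1" using assms(1,2) by (simp add: R lead_coeff_mult)
  ultimately have "R = 1" by (metis degree_0_id of_nat_0 of_nat_1 one_pCons)
  then show ?thesis using R by simp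
qed

lemma degree_pgcd_cong:
  assumes "\<And>R. R dvd P \<and> R dvd Q \<longleftrightarrow> R dvd P' \<and> R dvd Q'"
  shows "degree (pgcd P Q) = degree (pgcd P' Q')"
  by (intro degree_eq_of_mutual_dvd) (metis assms dvd_pgcd_iff dvd_refl)+

lemma degree_pgcd_eq:
  assumes "\<And>R. R dvd P \<and> R dvd Q \<longleftrightarrow> R dvd D"
  shows "degree (pgcd P Q) = degree D"
  by (intro degree_eq_of_mutual_dvd) (metis assms dvd_pgcd_iff dvd_refl)+

lemma coprime_iff_bezout:
  fixes P Q :: "'a::field poly"
  shows "coprime P Q \<longleftrightarrow> (\<exists>A B. A * P + B * Q = 1)"
proof
  assume "coprime P Q"
  then have "is_unit (pgcd P Q)"
    by (rule coprime_common_divisor) auto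
  then have "\<exists>A B. 1 = A * P + B * Q"
    using pgcd_principal[of P Q] by blast
  then show "\<exists>A B. A * P + B * Q = 1" by metis
next
  assume "\<exists>A B. A * P + B * Q = 1"
  then show "coprime P Q"
    by (intro coprimeI) (metis dvd_add dvd_mult)
qed

lemma coprime_poly_mult_right:
  fixes P Q R :: "'a::field poly"
  assumes "coprime P Q" "coprime P R"
  shows "coprime P (Q * R)"
proof -
  obtain A B C D where *: "A * P + B * Q = 1" "C * P + D * R = 1"
    using assms unfolding coprime_iff_bezout by blast
  have "(A * C * P + A * D * R + B * Q * C) * P + (B * D) * (Q * R) = (A * P + B * Q) * (C * P + D * R)"
    by (simp add: algebra_simps)
  also have "\<dots> = 1" using * by simp
  finally show ?thesis unfolding coprime_iff_bezout by blast
qed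

lemma coprime_poly_power_right:
  fixes P Q :: "'a::field poly"
  shows "coprime P Q \<Longrightarrow> coprime P (Q ^ n)"
  by (induction n) (auto intro: coprime_poly_mult_right)

lemma coprime_poly_dvd_cancel:
  fixes P Q R :: "'a::field poly"
  assumes "coprime P Q" "P dvd Q * R"
  shows "P dvd R"
proof -
  obtain A B where *: "A * P + B * Q = 1"
    using assms unfolding coprime_iff_bezout by blast
  have "R = (A * P + B * Q) * R" using * by simp
  also have "\<dots> = A * R * P + B * (Q * R)" by (simp add: algebra_simps)
  finally have "R = A * R * P + B * (Q * R)" .
  moreover have "P dvd A * R * P + B * (Q * R)" using assms(2) by (intro dvd_add) auto
  ultimately show ?thesis by simp
qed

lemma coprime_poly_mult_dvd:
  fixes P Q R :: "'a::field poly"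
  assumes "coprime P Q" "P dvd R" "Q dvd R"
  shows "P * Q dvd R"
proof -
  obtain S where "R = Q * S" using assms(3) by (elim dvdE)
  then have "P dvd S" using assms(1,2) by (blast intro: coprime_poly_dvd_cancel)
  then show ?thesis unfolding \<open>R = Q * S\<close> by (simp add: mult.commute[of P] mult_dvd_mono)
qed

lemma coprime_linear_iff:
  fixes P :: "'a::field poly"
  shows "coprime P [:- c, 1:] \<longleftrightarrow> poly P c \<noteq> 0"
proof
  assume coprime: "coprime P [:- c, 1:]"
  have "\<not> is_unit [:- c, 1:]" by (simp add: is_unit_iff_degree)
  then show "poly P c \<noteq> 0"
    using coprime_common_divisor[OF coprime, of "[:- c, 1:]"] by (auto simp: poly_eq_0_iff_dvd)
next
  assume nonroot: "poly P c \<noteq> 0"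
  have "poly (P - [:poly P c:]) c = 0" by simp
  then obtain S where "P - [:poly P c:] = [:- c, 1:] * S"
    unfolding poly_eq_0_iff_dvd by (auto elim: dvdE)
  then have S: "P = [:poly P c:] + [:- c, 1:] * S" by (simp add: algebra_simps)
  have "[:inverse (poly P c):] * P + (- [:inverse (poly P c):] * S) * [:- c, 1:]
      = [:inverse (poly P c):] * (P - [:- c, 1:] * S)"
    by (simp only: right_diff_distrib minus_mult_left[symmetric] mult.assoc mult.commute[of S] diff_conv_add_uminus[symmetric])
  also have "P - [:- c, 1:] * S = [:poly P c:]" using S by (metis add_diff_cancel_right')
  also have "[:inverse (poly P c):] * [:poly P c:] = 1" using nonroot by simp
  finally show "coprime P [:- c, 1:]" unfolding coprime_iff_bezout by blast
qed

text \<open>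
  The orders of a polynomial at \<open>c\<close> can be read off from its gcds with powers of \<open>X - c\<close>; this links the
  invariant factors with the numbers \<open>n\<^sub>k(u, c)\<close>.
\<close>

lemma degree_pgcd_linear_power:
  fixes D :: "'a::field poly"
  assumes "D \<noteq> 0"
  shows "degree (pgcd D ([:- c, 1:] ^ k)) = min k (order c D)"
proof -
  obtain S where S: "D = [:- c, 1:] ^ order c D * S" "\<not> [:- c, 1:] dvd S"
    using order_decomp[OF assms] by blast
  have cop: "coprime S ([:- c, 1:] ^ k)" for k
    using S(2) by (intro coprime_poly_power_right) (simp add: coprime_linear_iff poly_eq_0_iff_dvd)
  have "R dvd D \<and> R dvd [:- c, 1:] ^ k \<longleftrightarrow> R dvd [:- c, 1:] ^ min k (order c D)" for R
  proof
    assume R: "R dvd [:- c, 1:] ^ min k (order c D)"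
    moreover have "[:- c, 1:] ^ min k (order c D) dvd D"
      using order_1[of c D] le_imp_power_dvd[of "min k (order c D)" "order c D"] dvd_trans by (metis min.cobounded2)
    moreover have "[:- c, 1:] ^ min k (order c D) dvd [:- c, 1:] ^ k"
      by (rule le_imp_power_dvd) simp
    ultimately show "R dvd D \<and> R dvd [:- c, 1:] ^ k" using dvd_trans by blast
  next
    assume R: "R dvd D \<and> R dvd [:- c, 1:] ^ k"
    have "coprime R S"
      using coprime_divisors[OF _ dvd_refl, of R "[:- c, 1:] ^ k" S] R cop[of k] by (simp add: coprime_commute)
    moreover have "R dvd S * [:- c, 1:] ^ order c D" using R S(1) by (metis mult.commute)
    ultimately have "R dvd [:- c, 1:] ^ order c D" by (rule coprime_poly_dvd_cancel)
    then show "R dvd [:- c, 1:] ^ min k (order c D)" using R by (simp add: min_def)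
  qed
  then have "degree (pgcd D ([:- c, 1:] ^ k)) = degree ([:- c, 1:] ^ min k (order c D))"
    by (rule degree_pgcd_eq)
  then show ?thesis by (simp add: degree_linear_power)
qed

lemma power_dvd_minus_power:
  fixes Y :: "'a::comm_ring_1"
  assumes "i \<le> j"
  shows "Y ^ i dvd (- Y) ^ j"
  using assms by (metis dvd_mult le_imp_power_dvd power_minus)

lemma exists_irreducible_dvd:
  fixes P :: "'a::field poly"
  assumes "degree P > 0"
  obtains \<pi> where "irreducible \<pi>" "\<pi> dvd P"
proof -
  obtain \<pi> where \<pi>: "degree \<pi> > 0" "\<pi> dvd P"
    and min: "\<And>R. degree R > 0 \<Longrightarrow> R dvd P \<Longrightarrow> degree \<pi> \<le> degree R"
    using ex_has_least_nat[of "\<lambda>R. degree R > 0 \<and> R dvd P" P degree] assms by auto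
  have "irreducible \<pi>"
  proof (rule irreducibleI)
    show "\<pi> \<noteq> 0" using \<pi> by auto
    then show "\<not> is_unit \<pi>" using \<pi>(1) is_unit_iff_degree[of \<pi>] by simp
    fix A B assume AB: "\<pi> = A * B"
    then have nz: "A \<noteq> 0" "B \<noteq> 0" using \<pi> by auto
    then have deg: "degree \<pi> = degree A + degree B" by (simp add: AB degree_mult_eq)
    have "degree A = 0 \<or> degree \<pi> \<le> degree A"
      using min[of A] AB \<pi>(2) by (metis dvd_mult_left neq0_conv)
    then show "is_unit A \<or> is_unit B"
      using deg nz by (auto simp: is_unit_iff_degree)
  qed
  then show thesis using that \<pi> by blast
qed

lemma irreducible_imp_coprime_poly:
  fixes P Q :: "'a::field poly"
  assumes "irreducible P" "\<not> P dvd Q"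
  shows "coprime P Q"
proof (rule coprimeI)
  fix R assume R: "R dvd P" "R dvd Q"
  then obtain S where S: "P = R * S" by (auto simp: dvd_def)
  then have "is_unit R \<or> is_unit S" using assms(1) by (auto simp: irreducible_def)
  moreover have "\<not> is_unit S"
    using R(2) assms(2) S by (metis dvd_mult_unit_iff dvd_refl dvd_trans mult.commute mult_unit_dvd_iff)
  ultimately show "is_unit R" by blast
qed

lemma extract_power:
  fixes P \<pi> :: "'a::field poly"
  assumes "degree \<pi> > 0" "P \<noteq> 0"
  obtains e R where "P = \<pi> ^ e * R" "\<not> \<pi> dvd R"
proof -
  have "finite {n. \<pi> ^ n dvd P}"
  proof (rule finite_subset)
    show "{n. \<pi> ^ n dvd P} \<subseteq> {..degree P}"
    proof
      fix n assume "n \<in> {n. \<pi> ^ n dvd P}"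
      then have "degree (\<pi> ^ n) \<le> degree P" using dvd_imp_degree_le assms(2) by blast
      moreover have "degree (\<pi> ^ n) = n * degree \<pi>" using assms(1) by (intro degree_power_eq) auto
      ultimately have "n * degree \<pi> \<le> degree P" by simp
      moreover have "n * 1 \<le> n * degree \<pi>" using assms(1) by (intro mult_le_mono2) simp
      ultimately show "n \<in> {..degree P}" unfolding atMost_iff by linarith
    qed
  qed auto
  then have max: "n \<le> Max {n. \<pi> ^ n dvd P}" if "\<pi> ^ n dvd P" for n
    using that by (intro Max_ge) auto
  have "0 \<in> {n. \<pi> ^ n dvd P}" by simp
  then have e: "Max {n. \<pi> ^ n dvd P} \<in> {n. \<pi> ^ n dvd P}"
    using \<open>finite _\<close> by (intro Max_in) blast+
  define e where "e = Max {n. \<pi> ^ n dvd P}"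
  obtain R where R: "P = \<pi> ^ e * R" using e by (auto simp: dvd_def e_def)
  have "\<not> \<pi> dvd R"
  proof
    assume "\<pi> dvd R"
    then have "\<pi> ^ Suc e dvd P" unfolding R by (metis dvd_refl mult_dvd_mono power_Suc2)
    then show False using max[of "Suc e"] by (simp add: e_def)
  qed
  with R show thesis by (rule that)
qed

text \<open>
  Divisibility can be tested on prime powers, by splitting off one prime from \<open>Q\<close> and using that the
  resulting factors are coprime.
\<close>

lemma dvd_if_prime_powers_dvd:
  fixes P Q :: "'a::field poly"
  assumes "Q \<noteq> 0" and "\<And>\<pi> e. irreducible \<pi> \<Longrightarrow> \<pi> ^ e dvd Q \<Longrightarrow> \<pi> ^ e dvd P"
  shows "Q dvd P"
  using assms
proof (induction "degree Q" arbitrary: Q rule: less_induct)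
  case less
  show ?case
  proof (cases "degree Q = 0")
    case True
    then show ?thesis using less.prems(1) is_unit_iff_degree unit_imp_dvd by blast
  next
    case False
    then obtain \<pi> where \<pi>: "irreducible \<pi>" "\<pi> dvd Q" using exists_irreducible_dvd by blast
    then have deg: "degree \<pi> > 0"
      using is_unit_iff_degree[of \<pi>] by (auto simp: irreducible_def)
    then obtain e R where e: "Q = \<pi> ^ e * R" "\<not> \<pi> dvd R" using extract_power less.prems(1) by blast
    then have "e \<noteq> 0" using \<pi> by (metis mult_1 power_0)
    have nz: "R \<noteq> 0" "\<pi> \<noteq> 0" using e less.prems(1) deg by auto
    have "degree Q = e * degree \<pi> + degree R"
      using nz by (simp add: e degree_mult_eq degree_power_eq)
    then have "degree R < degree Q" using \<open>e \<noteq> 0\<close> deg by simp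
    then have "R dvd P"
      using less.hyps less.prems(2) nz(1) e(1) by (metis dvd_mult)
    moreover have "\<pi> ^ e dvd P" using less.prems(2)[OF \<pi>(1), of e] e(1) by simp
    moreover have "coprime R (\<pi> ^ e)"
      using irreducible_imp_coprime_poly[OF \<pi>(1) e(2)]
      by (intro coprime_poly_power_right) (simp add: coprime_commute)
    ultimately show ?thesis unfolding e(1)
      by (metis coprime_poly_mult_dvd mult.commute)
  qed
qed

text \<open>
  The numbers on both sides are the dimensions of the kernel of \<open>R(u)\<close>, computed from two lists of
  invariant factors. So this is the uniqueness of the invariant factors, and at the same time the
  criterion by which elementary factors are compared below. The largest polynomial comes first,
  because it can be recognized as the least \<open>R\<close> for which the sum is maximal.
\<close>

lemma divisor_chain_unique:
  fixes Ps Qs :: "'a::field poly list"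
  assumes "sorted_wrt (\<lambda>P Q. Q dvd P) Ps" "sorted_wrt (\<lambda>P Q. Q dvd P) Qs"
    and "\<forall>P\<in>set Ps. lead_coeff P = 1 \<and> degree P > 0" "\<forall>Q\<in>set Qs. lead_coeff Q = 1 \<and> degree Q > 0"
    and "\<And>R. (\<Sum>P\<leftarrow>Ps. degree (pgcd P R)) = (\<Sum>Q\<leftarrow>Qs. degree (pgcd Q R))"
  shows "Ps = Qs"
  using assms
proof (induction Ps arbitrary: Qs)
  have self: "degree (pgcd P R) = degree P" if "P dvd R" for P R :: "'a poly"
    using that dvd_trans by (intro degree_pgcd_eq) blast
  {
    case Nil
    have "(\<Sum>Q\<leftarrow>Qs. degree Q) = 0"
      using Nil(5)[of 0] by (simp add: self)
    then show ?case using Nil(4) by (cases Qs) auto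
  next
    case (Cons P Ps)
    have total: "(\<Sum>P\<leftarrow>P # Ps. degree P) = (\<Sum>Q\<leftarrow>Qs. degree Q)"
      using Cons(6)[of 0] by (simp add: self)
    then obtain Q Qs' where Qs: "Qs = Q # Qs'" using Cons(4) by (cases Qs) auto
    \<comment> \<open>Test with \<open>R = A\<close>, the largest polynomial of one list: there every summand attains its
      maximum, and the totals agree, so every summand of the other list attains its maximum, too.\<close>
    have head: "B dvd A" if "sorted_wrt (\<lambda>P Q. Q dvd P) (A # As)" "B \<noteq> 0"
      "(\<Sum>P\<leftarrow>A # As. degree (pgcd P A)) = (\<Sum>Q\<leftarrow>B # Bs. degree (pgcd Q A))"
      "(\<Sum>P\<leftarrow>A # As. degree P) = (\<Sum>Q\<leftarrow>B # Bs. degree Q)" "0 \<notin> set (B # Bs)" for A B :: "'a poly" and As Bs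
    proof -
      have "(\<Sum>P\<leftarrow>A # As. degree (pgcd P A)) = (\<Sum>P\<leftarrow>A # As. degree P)"
      proof -
        have "degree (pgcd P A) = degree P" if "P \<in> set (A # As)" for P
          using that \<open>sorted_wrt _ (A # As)\<close> by (intro self) auto
        then show ?thesis by (metis (mono_tags, lifting) map_cong)
      qed
      moreover have "(\<Sum>Q\<leftarrow>Bs. degree (pgcd Q A)) \<le> (\<Sum>Q\<leftarrow>Bs. degree Q)"
        using that(5) by (intro sum_list_mono dvd_imp_degree_le) auto
      moreover have "degree (pgcd B A) \<le> degree B" using that(2) by (intro dvd_imp_degree_le) auto
      ultimately have "degree (pgcd B A) = degree B" using that(3,4) by simp
      moreover obtain C where C: "B = pgcd B A * C" using pgcd_dvd(1)[of B A] by (auto simp: dvd_def)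
      moreover have "C \<noteq> 0" "pgcd B A \<noteq> 0" using that(2) C by auto
      ultimately have "degree C = 0" by (metis add_cancel_right_right degree_mult_eq)
      then have "is_unit C" using \<open>C \<noteq> 0\<close> is_unit_iff_degree by blast
      then show "B dvd A" using C pgcd_dvd(2)[of B A] by (metis mult_unit_dvd_iff)
    qed
    have nz: "0 \<notin> set (P # Ps)" "0 \<notin> set (Q # Qs')" using Cons(4,5) Qs by auto
    have "Q dvd P" using head[of P Ps Q Qs'] Cons(2) Cons(6)[of P] total nz Qs by simp
    moreover have "P dvd Q" using head[of Q Qs' P Ps] Cons(3) Cons(6)[of Q] total nz Qs by simp
    ultimately have "P = Q" using Cons(4,5) Qs by (intro monic_dvd_antisym) auto
    moreover have "Ps = Qs'"
      using Cons.prems \<open>P = Q\<close> Qs by (intro Cons.IH) auto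
    ultimately show ?case using Qs by simp
  }
qed

section \<open>Dimensions of direct sums and quotients\<close>

context finite_dimensional_vector_space
begin

text \<open>
  This recognizes a basis, given as a list, by counting dimensions.
\<close>

lemma independent_list_iff_dim:
  "distinct bs \<and> independent (set bs) \<longleftrightarrow> dim (span (set bs)) = length bs"
proof
  assume "distinct bs \<and> independent (set bs)"
  then show "dim (span (set bs)) = length bs"
    by (simp add: dim_eq_card_independent distinct_card)
next
  assume dim: "dim (span (set bs)) = length bs"
  have "dim (span (set bs)) \<le> card (set bs)" by (simp add: dim_le_card')
  then have "card (set bs) = length bs" using dim card_length[of bs] by simp
  then have "distinct bs" by (rule card_distinct)
  moreover have "independent (set bs)"
    using card_eq_dim[of "set bs" "span (set bs)"] \<open>card (set bs) = length bs\<close> dim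
    by (simp add: span_superset)
  ultimately show "distinct bs \<and> independent (set bs)" by blast
qed

definition direct_sum :: "'b set \<Rightarrow> 'b set \<Rightarrow> 'b set \<Rightarrow> bool" where
  "direct_sum W A B \<longleftrightarrow> W = {x + y |x y. x \<in> A \<and> y \<in> B} \<and> A \<inter> B = {0}"

lemma dim_direct_sum:
  assumes "subspace A" "subspace B" "direct_sum W A B"
  shows "dim W = dim A + dim B"
  using dim_sums_Int[OF assms(1,2)] assms(3) by (simp add: direct_sum_def)

lemma direct_sum_unique:
  assumes "subspace A" "subspace B" "direct_sum W A B"
    and "a \<in> A" "a' \<in> A" "b \<in> B" "b' \<in> B" "a + b = a' + b'"
  shows "a = a'" "b = b'"
proof -
  have "a - a' = b' - b" using assms(8) by (simp add: algebra_simps)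
  moreover have "a - a' \<in> A" "b' - b \<in> B" using assms by (auto intro: subspace_diff)
  ultimately have "a - a' \<in> A \<inter> B" by simp
  then have "a - a' = 0" using assms(3) unfolding direct_sum_def by blast
  then show "a = a'" "b = b'" using assms(8) by auto
qed

lemma direct_sum_commute: "direct_sum W A B \<longleftrightarrow> direct_sum W B A"
proof -
  have "{x + y |x y. x \<in> A \<and> y \<in> B} = {x + y |x y. x \<in> B \<and> y \<in> A}"
    using add.commute by blast
  then show ?thesis by (simp add: direct_sum_def Int_commute)
qed

text \<open>
  \<open>f\<close> induces an injection from \<open>T / S\<close> into \<open>T' / S'\<close>, stated without quotient spaces.
\<close>

lemma dim_diff_le_of_linear:
  assumes "Vector_Spaces.linear scale scale f"
    and "subspace S" "subspace T" "S \<subseteq> T" "subspace S'" "subspace T'" "S' \<subseteq> T'"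
    and "\<And>x. x \<in> T \<Longrightarrow> f x \<in> T'" "\<And>x. x \<in> T \<Longrightarrow> f x \<in> S' \<Longrightarrow> x \<in> S"
  shows "int (dim T) - int (dim S) \<le> int (dim T') - int (dim S')"
proof -
  interpret f: Vector_Spaces.linear scale scale f by fact
  interpret pair: finite_dimensional_vector_space_pair scale Basis scale Basis by unfold_locales
  obtain B where B: "B \<subseteq> S" "independent B" "span B = S"
    using basis_subspace_exists[OF assms(2)] by metis
  obtain C where C: "B \<subseteq> C" "C \<subseteq> T" "independent C" "T \<subseteq> span C"
    using maximal_independent_subset_extend[of B T] B assms(4) by (metis subset_trans)
  have fin: "finite C" "finite B" using C(3) B(2) finiteI_independent by auto
  \<comment> \<open>\<open>N\<close> is a complement of \<open>S\<close> in \<open>T\<close>; \<open>f\<close> embeds it into \<open>T'\<close>, with an image that meets \<open>S'\<close>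
    trivially.\<close>
  define N where "N = span (C - B)"
  have sN: "subspace N" by (simp add: N_def)
  have NT: "N \<subseteq> T" unfolding N_def using C(2) assms(3) by (intro span_minimal) auto
  have "dim T = card C" using C basis_card_eq_dim by metis
  moreover have "dim S = card B" using B dim_eq_card_independent by (metis dim_span)
  moreover have "dim N = card (C - B)"
    unfolding N_def using C(3) by (metis Diff_subset dim_span_eq_card_independent independent_mono)
  ultimately have dims: "dim T = dim S + dim N"
    using C(1) fin by (simp add: card_Diff_subset card_mono)
  have "T = {x + y |x y. x \<in> S \<and> y \<in> N}"
    using span_Un[of B "C - B"] C(1,2,4) B(3) span_subspace[OF C(2,4) assms(3)]
    by (simp add: N_def Un_absorb1)
  then have "dim (S \<inter> N) = 0"
    using dim_sums_Int[OF assms(2) sN] dims by simp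
  then have SN: "S \<inter> N \<subseteq> {0}" by simp
  have "inj_on f N"
  proof (subst f.inj_on_iff_eq_0[OF sN], intro ballI impI)
    fix x assume "x \<in> N" "f x = 0"
    then have "f x \<in> S'" using subspace_0[OF assms(5)] by simp
    then have "x \<in> S" using assms(9) \<open>x \<in> N\<close> NT by blast
    then show "x = 0" using SN \<open>x \<in> N\<close> by blast
  qed
  then have "dim (f ` N) = dim N"
    using pair.dim_image_eq[OF assms(1), of N] sN by (simp add: span_eq_iff[THEN iffD2])
  moreover have sfN: "subspace (f ` N)" by (rule f.subspace_image[OF sN])
  moreover have "f ` N \<inter> S' \<subseteq> {0}"
  proof
    fix y assume "y \<in> f ` N \<inter> S'"
    then obtain x where x: "x \<in> N" "y = f x" "f x \<in> S'" by blast
    then have "x \<in> S \<inter> N" using assms(9) NT by blast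
    then show "y \<in> {0}" using SN x f.zero by blast
  qed
  moreover from this have "dim (f ` N \<inter> S') = 0" by (rule dim_eq_0[THEN iffD2])
  ultimately have "dim {x + y |x y. x \<in> f ` N \<and> y \<in> S'} = dim N + dim S'"
    using dim_sums_Int[OF sfN assms(5)] by linarith
  moreover have "dim {x + y |x y. x \<in> f ` N \<and> y \<in> S'} \<le> dim T'"
  proof (rule dim_subset, rule subsetI)
    fix z assume "z \<in> {x + y |x y. x \<in> f ` N \<and> y \<in> S'}"
    then obtain x y where "z = f x + y" "x \<in> N" "y \<in> S'" by blast
    then show "z \<in> T'" using assms(6-8) NT by (simp add: subspace_add subset_iff)
  qed
  ultimately show ?thesis using dims by linarith
qed

end

section \<open>The polynomial action of an endomorphism\<close>

text \<open>
  An endomorphism turns the space into a module over the polynomial ring.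
\<close>

locale endomorphism = finite_dimensional_vector_space scale Basis
  for scale :: "'a::field \<Rightarrow> 'b::ab_group_add \<Rightarrow> 'b" (infixr "*s" 75) and Basis :: "'b set" +
  fixes u :: "'b \<Rightarrow> 'b"
  assumes linear_u: "Vector_Spaces.linear scale scale u"

begin

sublocale u: Vector_Spaces.linear scale scale u
  by (rule linear_u)

abbreviation act :: "'a poly \<Rightarrow> 'b \<Rightarrow> 'b" (infixr "\<star>" 76) where
  "P \<star> x \<equiv> poly_endo scale P u x"

lemma act_eq_sum:
  assumes "\<And>i. i \<ge> n \<Longrightarrow> coeff P i = 0"
  shows "P \<star> x = (\<Sum>i<n. coeff P i *s (u ^^ i) x)"
proof -
  have "(\<Sum>i<n. coeff P i *s (u ^^ i) x) = (\<Sum>i\<in>{i. i < n \<and> coeff P i \<noteq> 0}. coeff P i *s (u ^^ i) x)"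
    by (rule sum.mono_neutral_right) auto
  also have "{i. i < n \<and> coeff P i \<noteq> 0} = {i. i \<le> degree P \<and> coeff P i \<noteq> 0}"
    using assms le_degree by (metis not_le)
  also have "(\<Sum>i\<in>{i. i \<le> degree P \<and> coeff P i \<noteq> 0}. coeff P i *s (u ^^ i) x) = P \<star> x"
    unfolding poly_endo_def by (rule sum.mono_neutral_left) auto
  finally show ?thesis ..
qed

lemma act_0 [simp]: "0 \<star> x = 0"
  by (simp add: poly_endo_def)

lemma act_const [simp]: "[:c:] \<star> x = c *s x"
  by (simp add: poly_endo_def)

lemma act_1 [simp]: "1 \<star> x = x"
  using act_const[of 1 x] by (simp add: one_pCons)

lemma act_add_left: "(P + Q) \<star> x = P \<star> x + Q \<star> x"
proof -
  define n where "n = Suc (max (degree P) (degree Q))"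
  have "coeff P i = 0" "coeff Q i = 0" if "i \<ge> n" for i
    using that by (auto simp: n_def intro!: coeff_eq_0)
  then show ?thesis
    by (simp add: act_eq_sum[of n] scale_left_distrib sum.distrib)
qed

lemma act_smult: "(Polynomial.smult c P) \<star> x = c *s (P \<star> x)"
  by (cases "c = 0") (simp_all add: poly_endo_def scale_sum_right)

lemma act_minus_left: "(- P) \<star> x = - (P \<star> x)"
  using act_smult[of "- 1" P x] by simp

lemma act_diff_left: "(P - Q) \<star> x = P \<star> x - Q \<star> x"
  using act_add_left[of P "- Q" x] by (simp add: act_minus_left)

lemma linear_power: "Vector_Spaces.linear scale scale (u ^^ i)"
proof (induction i)
  case 0
  then show ?case by (simp add: Vector_Spaces.linear_iff vector_space_axioms)
next
  case (Suc i)
  then show ?case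
    using u.linear_axioms unfolding Vector_Spaces.linear_iff by (simp add: u.add u.scale)
qed

lemma act_add: "P \<star> (x + y) = P \<star> x + P \<star> y"
  and act_scale: "P \<star> (c *s x) = c *s (P \<star> x)"
proof -
  have "(u ^^ i) (x + y) = (u ^^ i) x + (u ^^ i) y" "(u ^^ i) (c *s x) = c *s (u ^^ i) x" for i
    using linear_power[of i] unfolding Vector_Spaces.linear_iff by blast+
  then show "P \<star> (x + y) = P \<star> x + P \<star> y" "P \<star> (c *s x) = c *s (P \<star> x)"
    by (simp_all add: poly_endo_def scale_right_distrib sum.distrib scale_sum_right mult.commute)
qed

lemma linear_act: "Vector_Spaces.linear scale scale (act P)"
  by (simp add: Vector_Spaces.linear_iff vector_space_axioms act_add act_scale)

sublocale act: Vector_Spaces.linear scale scale "act P" for P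
  by (rule linear_act)

lemma act_pCons: "pCons c P \<star> x = c *s x + u (P \<star> x)"
proof -
  define n where "n = Suc (degree P)"
  have n: "coeff P i = 0" if "i \<ge> n" for i
    using that by (auto simp: n_def intro!: coeff_eq_0)
  have "pCons c P \<star> x = (\<Sum>i<Suc n. coeff (pCons c P) i *s (u ^^ i) x)"
    by (rule act_eq_sum) (auto simp: coeff_pCons n split: nat.splits)
  also have "\<dots> = c *s x + (\<Sum>i<n. coeff P i *s u ((u ^^ i) x))"
    by (subst sum.lessThan_Suc_shift) simp
  also have "(\<Sum>i<n. coeff P i *s u ((u ^^ i) x)) = u (P \<star> x)"
    by (simp add: act_eq_sum[OF n] u.sum u.scale)
  finally show ?thesis .
qed

lemma act_X [simp]: "[:0, 1:] \<star> x = u x"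
  by (simp add: act_pCons)

lemma act_linear_poly: "[:- c, 1:] \<star> x = u x - c *s x"
  by (simp add: act_pCons)

lemma act_mult: "(P * Q) \<star> x = P \<star> Q \<star> x"
  by (induction P) (simp_all add: act_pCons act_add_left act_smult)

lemma act_commute: "P \<star> Q \<star> x = Q \<star> P \<star> x"
  by (metis act_mult mult.commute)

lemma act_power: "(P ^ k) \<star> x = (act P ^^ k) x"
  by (induction k) (simp_all add: act_mult)

lemma act_eq_0_dvd: "P \<star> x = 0 \<Longrightarrow> P dvd Q \<Longrightarrow> Q \<star> x = 0"
  by (elim dvdE) (simp add: act_mult act_commute[of P])

text \<open>
  By Bezout, the intersection of two kernels is the kernel of the gcd.
\<close>

lemma act_pgcd_eq_0_iff: "pgcd P Q \<star> x = 0 \<longleftrightarrow> P \<star> x = 0 \<and> Q \<star> x = 0"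
proof
  assume "pgcd P Q \<star> x = 0"
  then show "P \<star> x = 0 \<and> Q \<star> x = 0"
    using act_eq_0_dvd[OF _ pgcd_dvd(1)[of P Q]] act_eq_0_dvd[OF _ pgcd_dvd(2)[of P Q]] by simp
next
  assume "P \<star> x = 0 \<and> Q \<star> x = 0"
  moreover obtain A B where "pgcd P Q = A * P + B * Q" by (rule pgcd_bezout)
  ultimately show "pgcd P Q \<star> x = 0" by (simp add: act_add_left act_mult)
qed

lemma coprime_act_eq_0:
  assumes "coprime P Q" "P \<star> x = 0" "Q \<star> x = 0"
  shows "x = 0"
proof -
  obtain A B where "A * P + B * Q = 1" using assms(1) coprime_iff_bezout by blast
  then have "x = (A * P + B * Q) \<star> x" by simp
  also have "\<dots> = 0" using assms by (simp add: act_add_left act_mult)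
  finally show ?thesis .
qed

text \<open>
  The stable subspaces are the submodules over the polynomial ring.
\<close>

definition stable :: "'b set \<Rightarrow> bool" where
  "stable W \<longleftrightarrow> subspace W \<and> (\<forall>x\<in>W. u x \<in> W)"

lemma stable_act: "stable W \<Longrightarrow> x \<in> W \<Longrightarrow> P \<star> x \<in> W"
  by (induction P) (auto simp: stable_def act_pCons subspace_0 intro!: subspace_add subspace_scale)

lemma stable_UNIV: "stable UNIV"
  by (simp add: stable_def)

lemma stable_kernel: "stable W \<Longrightarrow> stable {x \<in> W. P \<star> x = 0}"
proof -
  assume W: "stable W"
  have "P \<star> u x = u (P \<star> x)" for x
    using act_commute[of P "[:0, 1:]" x] by simp
  then show ?thesis
    using W unfolding stable_def subspace_def by (auto simp: act_add act_scale)
qed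

lemma direct_sum_subset:
  assumes "stable A" "stable B" "direct_sum W A B"
  shows "A \<subseteq> W" "B \<subseteq> W"
proof -
  have "a = a + 0" "a = 0 + a" "0 \<in> A" "0 \<in> B" for a :: 'b
    using assms subspace_0 by (simp_all add: stable_def)
  then show "A \<subseteq> W" "B \<subseteq> W" using assms(3) unfolding direct_sum_def by blast+
qed

lemma direct_sum_kernel:
  assumes "stable A" "stable B" "direct_sum W A B"
  shows "direct_sum {y \<in> W. R \<star> y = 0} {y \<in> A. R \<star> y = 0} {y \<in> B. R \<star> y = 0}"
  unfolding direct_sum_def
proof
  have sA: "subspace A" and sB: "subspace B" using assms by (simp_all add: stable_def)
  show "{y \<in> A. R \<star> y = 0} \<inter> {y \<in> B. R \<star> y = 0} = {0}"
  proof -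
    have "A \<inter> B = {0}" using assms(3) by (simp add: direct_sum_def)
    then show ?thesis using act.zero[of R] by blast
  qed
  show "{y \<in> W. R \<star> y = 0} = {a + b |a b. a \<in> {y \<in> A. R \<star> y = 0} \<and> b \<in> {y \<in> B. R \<star> y = 0}}"
  proof (intro equalityI subsetI)
    fix y assume "y \<in> {y \<in> W. R \<star> y = 0}"
    then obtain a b where ab: "y = a + b" "a \<in> A" "b \<in> B" "R \<star> y = 0"
      using assms(3) unfolding direct_sum_def by blast
    then have sum: "R \<star> a + R \<star> b = 0 + 0" by (simp add: act_add)
    have "R \<star> a = 0" "R \<star> b = 0"
      using direct_sum_unique[OF sA sB assms(3) _ _ _ _ sum] ab(2,3) assms(1,2) sA sB
      by (auto intro: stable_act subspace_0)
    then show "y \<in> {a + b |a b. a \<in> {y \<in> A. R \<star> y = 0} \<and> b \<in> {y \<in> B. R \<star> y = 0}}" using ab by blast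
  next
    fix y assume "y \<in> {a + b |a b. a \<in> {y \<in> A. R \<star> y = 0} \<and> b \<in> {y \<in> B. R \<star> y = 0}}"
    then obtain a b where "y = a + b" "a \<in> A" "b \<in> B" "R \<star> a = 0" "R \<star> b = 0" by blast
    moreover from this have "y \<in> W" using assms(3) unfolding direct_sum_def by blast
    ultimately show "y \<in> {y \<in> W. R \<star> y = 0}" by (simp add: act_add)
  qed
qed

section \<open>Cyclic subspaces\<close>

text \<open>
  \<open>P\<close> generates the annihilator ideal of \<open>x\<close>, up to a unit: products and quotients of such generators
  occur, so normalization is imposed separately.
\<close>

definition annihilator :: "'b \<Rightarrow> 'a poly \<Rightarrow> bool" where
  "annihilator x P \<longleftrightarrow> P \<noteq> 0 \<and> (\<forall>Q. Q \<star> x = 0 \<longleftrightarrow> P dvd Q)"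

lemma annihilator_dvd_iff: "annihilator x P \<Longrightarrow> Q \<star> x = 0 \<longleftrightarrow> P dvd Q"
  by (simp add: annihilator_def)

lemma annihilator_nonzero: "annihilator x P \<Longrightarrow> P \<noteq> 0"
  by (simp add: annihilator_def)

abbreviation cyclic :: "'b \<Rightarrow> 'b set" where
  "cyclic x \<equiv> range (\<lambda>P. P \<star> x)"

lemma stable_cyclic: "stable (cyclic x)"
  unfolding stable_def subspace_def
proof (intro conjI ballI allI)
  show "0 \<in> cyclic x" by (rule range_eqI[of _ _ 0]) simp
  fix y z c assume "y \<in> cyclic x"
  then obtain P where P: "y = P \<star> x" by blast
  have "c *s y = Polynomial.smult c P \<star> x" "u y = pCons 0 P \<star> x"
    by (simp_all add: P act_smult act_pCons)
  then show "c *s y \<in> cyclic x" "u y \<in> cyclic x" by blast+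
  assume "z \<in> cyclic x"
  then obtain Q where Q: "z = Q \<star> x" by blast
  have "y + z = (P + Q) \<star> x" by (simp add: P Q act_add_left)
  then show "y + z \<in> cyclic x" by blast
qed

lemma cyclic_subset: "stable W \<Longrightarrow> x \<in> W \<Longrightarrow> cyclic x \<subseteq> W"
  using stable_act by blast

lemma in_span_powers_iff:
  "y \<in> span ((\<lambda>j. (u ^^ j) x) ` {..<n}) \<longleftrightarrow> (\<exists>P. (\<forall>i\<ge>n. coeff P i = 0) \<and> y = P \<star> x)"
proof
  assume "y \<in> span ((\<lambda>j. (u ^^ j) x) ` {..<n})"
  \<comment> \<open>The right-hand side describes a subspace that contains the generators.\<close>
  moreover have "subspace {P \<star> x |P. \<forall>i\<ge>n. coeff P i = 0}"
    unfolding subspace_def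
  proof (intro conjI ballI allI)
    show "0 \<in> {P \<star> x |P. \<forall>i\<ge>n. coeff P i = 0}" by (auto intro!: exI[where x = 0])
    fix y z c assume "y \<in> {P \<star> x |P. \<forall>i\<ge>n. coeff P i = 0}"
    then obtain P where P: "y = P \<star> x" "\<forall>i\<ge>n. coeff P i = 0" by blast
    then show "c *s y \<in> {P \<star> x |P. \<forall>i\<ge>n. coeff P i = 0}"
      by (auto simp: act_smult intro!: exI[where x = "Polynomial.smult c P"])
    assume "z \<in> {P \<star> x |P. \<forall>i\<ge>n. coeff P i = 0}"
    then obtain Q where "z = Q \<star> x" "\<forall>i\<ge>n. coeff Q i = 0" by blast
    then show "y + z \<in> {P \<star> x |P. \<forall>i\<ge>n. coeff P i = 0}"
      using P by (auto simp: act_add_left intro!: exI[where x = "P + Q"])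
  qed
  moreover have "(\<lambda>j. (u ^^ j) x) ` {..<n} \<subseteq> {P \<star> x |P. \<forall>i\<ge>n. coeff P i = 0}"
  proof
    fix y assume "y \<in> (\<lambda>j. (u ^^ j) x) ` {..<n}"
    then obtain j where j: "j < n" "y = (u ^^ j) x" by blast
    then have "y = monom 1 j \<star> x" by (simp add: poly_endo_def degree_monom_eq sum.delta if_distrib[of "\<lambda>c. c *s _"] cong: if_cong)
    then show "y \<in> {P \<star> x |P. \<forall>i\<ge>n. coeff P i = 0}" using j by auto
  qed
  ultimately have "y \<in> {P \<star> x |P. \<forall>i\<ge>n. coeff P i = 0}" using span_minimal by blast
  then show "\<exists>P. (\<forall>i\<ge>n. coeff P i = 0) \<and> y = P \<star> x" by blast
next
  assume "\<exists>P. (\<forall>i\<ge>n. coeff P i = 0) \<and> y = P \<star> x"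
  then obtain P where "\<forall>i\<ge>n. coeff P i = 0" "y = P \<star> x" by blast
  then show "y \<in> span ((\<lambda>j. (u ^^ j) x) ` {..<n})"
    by (simp add: act_eq_sum[of n]) (intro span_sum span_scale span_base, auto)
qed

text \<open>
  Below the degree of the annihilator, every new power of \<open>u\<close> leaves the span of the previous ones. If no
  polynomial annihilated \<open>x\<close>, the dimensions would exceed any bound.
\<close>

lemma dim_span_powers:
  assumes "\<And>P. P \<noteq> 0 \<Longrightarrow> degree P < n \<Longrightarrow> P \<star> x \<noteq> 0"
  shows "dim (span ((\<lambda>j. (u ^^ j) x) ` {..<n})) = n"
  using assms
proof (induction n)
  case 0
  then show ?case by simp
next
  case (Suc n)
  \<comment> \<open>Otherwise a monic polynomial of degree \<open>n\<close> would annihilate \<open>x\<close>.\<close>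
  have "(u ^^ n) x \<notin> span ((\<lambda>j. (u ^^ j) x) ` {..<n})"
  proof
    assume "(u ^^ n) x \<in> span ((\<lambda>j. (u ^^ j) x) ` {..<n})"
    then obtain P where P: "\<forall>i\<ge>n. coeff P i = 0" "(u ^^ n) x = P \<star> x"
      unfolding in_span_powers_iff by blast
    define Q where "Q = monom 1 n - P"
    have "coeff Q n = 1" using P(1) by (simp add: Q_def)
    then have "Q \<noteq> 0" by auto
    moreover have "degree Q \<le> n" using P(1) by (intro degree_le) (simp add: Q_def)
    moreover have "Q \<star> x = 0"
      unfolding Q_def using P(2)
      by (simp add: act_diff_left poly_endo_def[of _ "monom 1 n"] degree_monom_eq sum.delta if_distrib[of "\<lambda>c. c *s _"] cong: if_cong)
    ultimately show False using Suc.prems[of Q] by simp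
  qed
  then show ?case using Suc by (simp add: lessThan_Suc dim_insert)
qed

lemma annihilator_exists: obtains P where "annihilator x P" "lead_coeff P = 1"
proof -
  define n where "n = Suc dimension"
  have "dim (span ((\<lambda>j. (u ^^ j) x) ` {..<n})) < n"
    using dim_subset_UNIV[of "span ((\<lambda>j. (u ^^ j) x) ` {..<n})"] by (simp add: n_def)
  then obtain P0 where P0: "P0 \<noteq> 0" "P0 \<star> x = 0"
    using dim_span_powers[of n x] by fastforce
  obtain P where "lead_coeff P = 1" "\<And>Q. Q \<in> {Q. Q \<star> x = 0} \<longleftrightarrow> P dvd Q"
    by (rule poly_ideal_generator[of "{Q. Q \<star> x = 0}" P0]) (auto simp: P0 act_add_left act_mult)
  then show thesis using that[of P] by (force simp: annihilator_def)
qed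

lemma cyclic_eq_span_powers:
  assumes "annihilator x P"
  shows "cyclic x = span ((\<lambda>j. (u ^^ j) x) ` {..<degree P})"
proof
  have "P \<noteq> 0" using assms by (auto simp: annihilator_def)
  show "cyclic x \<subseteq> span ((\<lambda>j. (u ^^ j) x) ` {..<degree P})"
  proof
    fix y assume "y \<in> cyclic x"
    then obtain Q where Q: "y = Q \<star> x" by blast
    have "y = (P * (Q div P) + Q mod P) \<star> x" unfolding Q by simp
    also have "\<dots> = (Q mod P) \<star> x"
      using assms unfolding act_add_left by (simp add: annihilator_def)
    moreover have "\<forall>i\<ge>degree P. coeff (Q mod P) i = 0"
      using degree_mod_less[OF \<open>P \<noteq> 0\<close>, of Q] by (auto intro: coeff_eq_0)
    ultimately show "y \<in> span ((\<lambda>j. (u ^^ j) x) ` {..<degree P})"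
      unfolding in_span_powers_iff by metis
  qed
  show "span ((\<lambda>j. (u ^^ j) x) ` {..<degree P}) \<subseteq> cyclic x"
    by (auto simp: in_span_powers_iff)
qed

lemma dim_cyclic:
  assumes "annihilator x P"
  shows "dim (cyclic x) = degree P"
  unfolding cyclic_eq_span_powers[OF assms]
proof (rule dim_span_powers)
  fix Q :: "'a poly" assume "Q \<noteq> 0" "degree Q < degree P"
  then show "Q \<star> x \<noteq> 0" using assms dvd_imp_degree_le[of P Q] by (auto simp: annihilator_def)
qed

lemma annihilator_act:
  assumes "annihilator x (A * B)"
  shows "annihilator (A \<star> x) B"
proof -
  have "A \<noteq> 0" using assms by (auto simp: annihilator_def)
  have "Q \<star> A \<star> x = 0 \<longleftrightarrow> B dvd Q" for Q
  proof -
    have "Q \<star> A \<star> x = 0 \<longleftrightarrow> A * B dvd A * Q"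
      using assms(1) unfolding annihilator_def by (metis act_mult mult.commute)
    then show ?thesis using \<open>A \<noteq> 0\<close> by simp
  qed
  then show ?thesis using assms by (simp add: annihilator_def)
qed

text \<open>
  Multiplying by \<open>A\<close> kills \<open>x\<close> and is invertible on the module generated by \<open>y\<close>, and conversely for \<open>B\<close>.
\<close>

lemma annihilator_add:
  assumes "annihilator x A" "annihilator y B" "coprime A B"
  shows "annihilator (x + y) (A * B)"
proof -
  have "Q \<star> (x + y) = 0 \<longleftrightarrow> A * B dvd Q" for Q
  proof
    assume Q: "Q \<star> (x + y) = 0"
    have "A \<star> x = 0" "B \<star> y = 0" using assms by (simp_all add: annihilator_dvd_iff)
    then have "(A * Q) \<star> y = A \<star> Q \<star> (x + y)" "(B * Q) \<star> x = B \<star> Q \<star> (x + y)"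
      by (simp_all add: act_add act_mult act_commute[of A Q] act_commute[of B Q])
    then have "(A * Q) \<star> y = 0" "(B * Q) \<star> x = 0" using Q by simp_all
    then have "B dvd A * Q" "A dvd B * Q" using assms by (simp_all add: annihilator_dvd_iff)
    then have "B dvd Q" "A dvd Q"
      using assms(3) by (blast intro: coprime_poly_dvd_cancel coprime_commute[THEN iffD1])+
    then show "A * B dvd Q" using assms(3) by (blast intro: coprime_poly_mult_dvd)
  next
    assume "A * B dvd Q"
    then have "A dvd Q" "B dvd Q" by (auto intro: dvd_mult_left dvd_mult_right)
    then have "Q \<star> x = 0" "Q \<star> y = 0"
      using annihilator_dvd_iff[OF assms(1)] annihilator_dvd_iff[OF assms(2)] by simp_all
    then show "Q \<star> (x + y) = 0" by (simp add: act_add)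
  qed
  then show ?thesis using assms by (simp add: annihilator_def)
qed

lemma dim_kernel_cyclic:
  assumes "annihilator x P"
  shows "dim {y \<in> cyclic x. R \<star> y = 0} = degree (pgcd P R)"
proof -
  have "P \<noteq> 0" using assms by (auto simp: annihilator_def)
  define D where "D = pgcd P R"
  have "D \<noteq> 0" using \<open>P \<noteq> 0\<close> by (simp add: D_def)
  obtain A where A: "P = A * D" unfolding D_def by (metis pgcd_dvd(1) dvd_def mult.commute)
  have "A \<noteq> 0" using A \<open>P \<noteq> 0\<close> by auto
  have ann: "annihilator (A \<star> x) D"
    using annihilator_act assms A by blast
  \<comment> \<open>The kernel is again cyclic, generated by the cofactor of the gcd.\<close>
  have "{y \<in> cyclic x. R \<star> y = 0} = cyclic (A \<star> x)"
  proof (intro equalityI subsetI)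
    fix y assume "y \<in> {y \<in> cyclic x. R \<star> y = 0}"
    then obtain Q where Q: "y = Q \<star> x" "R \<star> Q \<star> x = 0" by blast
    have "P \<star> x = 0" using assms by (simp add: annihilator_def)
    then have "P \<star> Q \<star> x = 0" using act_commute[of P Q x] by simp
    then have "D \<star> Q \<star> x = 0" using Q(2) by (simp add: D_def act_pgcd_eq_0_iff)
    then have "(D * Q) \<star> x = 0" by (simp add: act_mult)
    then have "A * D dvd D * Q" using assms A unfolding annihilator_def by blast
    then have "A dvd Q" using \<open>D \<noteq> 0\<close> by (simp add: mult.commute)
    then obtain S where "Q = S * A" by (metis dvd_def mult.commute)
    then show "y \<in> cyclic (A \<star> x)" using Q by (auto simp: act_mult)
  next
    fix y assume "y \<in> cyclic (A \<star> x)"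
    then obtain Q where Q: "y = (Q * A) \<star> x" by (auto simp: act_mult)
    have "R \<star> A \<star> x = 0"
      using ann pgcd_dvd(2)[of P R] unfolding annihilator_def D_def[symmetric] by blast
    then have "R \<star> y = 0" unfolding Q act_mult by (simp add: act_commute[of R Q])
    then show "y \<in> {y \<in> cyclic x. R \<star> y = 0}" using Q by blast
  qed
  then show ?thesis using dim_cyclic[OF ann] by (simp add: D_def)
qed

section \<open>Cyclic decompositions\<close>

text \<open>
  Over a finite field a generic vector need not exist, so a vector whose annihilator has maximal degree
  is taken, and a prime power missing in it would allow to enlarge it.
\<close>

lemma exists_maximal_annihilator:
  assumes W: "stable W"
  obtains x P where "x \<in> W" "annihilator x P" "lead_coeff P = 1" "\<And>y. y \<in> W \<Longrightarrow> P \<star> y = 0"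
proof -
  have "0 \<in> W" using W subspace_0 by (simp add: stable_def)
  \<comment> \<open>\<open>P\<close> is an annihilator of maximal degree \<open>d\<close> among the vectors of \<open>W\<close>.\<close>
  define good where "good d \<longleftrightarrow> (\<exists>x P. x \<in> W \<and> annihilator x P \<and> lead_coeff P = 1 \<and> degree P = d)" for d
  have "\<exists>d. good d" unfolding good_def using annihilator_exists \<open>0 \<in> W\<close> by metis
  then obtain d0 where "good d0" by blast
  moreover have "d \<le> dimension" if "good d" for d
    using that dim_cyclic dim_subset_UNIV unfolding good_def by metis
  ultimately obtain d where d: "good d" and max: "\<And>e. good e \<Longrightarrow> e \<le> d"
    using ex_has_greatest_nat[of good d0 id "Suc dimension"] by (force simp: less_Suc_eq_le)
  obtain x P where x: "x \<in> W" "annihilator x P" "lead_coeff P = 1" "degree P = d"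
    using d by (auto simp: good_def)
  have "P \<star> y = 0" if y: "y \<in> W" for y
  proof -
    obtain Q where Q: "annihilator y Q" by (rule annihilator_exists)
    have "Q dvd P"
    proof (rule dvd_if_prime_powers_dvd[OF annihilator_nonzero[OF Q]], rule ccontr)
      fix \<pi> e
      assume \<pi>: "irreducible \<pi>" "\<pi> ^ e dvd Q" "\<not> \<pi> ^ e dvd P"
      then have deg: "degree \<pi> > 0" "\<pi> \<noteq> 0"
        using is_unit_iff_degree[of \<pi>] by (auto simp: irreducible_def)
      \<comment> \<open>If a prime power \<open>\<pi> ^ e\<close> divides \<open>Q\<close> but not \<open>P\<close>, replacing the \<open>\<pi>\<close>-part of \<open>P\<close> by
        \<open>\<pi> ^ e\<close> gives the annihilator of another vector of \<open>W\<close>, of larger degree.\<close>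
      obtain f R where P: "P = \<pi> ^ f * R" "\<not> \<pi> dvd R"
        using extract_power[OF deg(1) annihilator_nonzero[OF x(2)]] by blast
      have "f < e" using \<pi>(3) unfolding P(1) by (metis dvd_triv_left dvd_trans le_imp_power_dvd not_le)
      obtain T where T: "Q = T * \<pi> ^ e" using \<pi>(2) by (metis dvd_def mult.commute)
      have "annihilator (\<pi> ^ f \<star> x) R" using annihilator_act x(2) P(1) by blast
      moreover have "annihilator (T \<star> y) (\<pi> ^ e)" using annihilator_act Q T by blast
      moreover have "coprime R (\<pi> ^ e)"
        using irreducible_imp_coprime_poly[OF \<pi>(1) P(2)]
        by (intro coprime_poly_power_right) (simp add: coprime_commute)
      ultimately have ann: "annihilator (\<pi> ^ f \<star> x + T \<star> y) (R * \<pi> ^ e)" by (rule annihilator_add)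
      have mem: "\<pi> ^ f \<star> x + T \<star> y \<in> W"
        using W x(1) y by (auto intro!: subspace_add stable_act simp: stable_def)
      obtain S where S: "annihilator (\<pi> ^ f \<star> x + T \<star> y) S" "lead_coeff S = 1"
        by (rule annihilator_exists)
      then have "good (degree S)" using mem unfolding good_def by blast
      moreover have "degree S = degree (R * \<pi> ^ e)"
        using dim_cyclic[OF S(1)] dim_cyclic[OF ann] by simp
      ultimately have "degree (R * \<pi> ^ e) \<le> d" using max by simp
      moreover have "R \<noteq> 0" using P(2) by auto
      ultimately have "degree R + e * degree \<pi> \<le> f * degree \<pi> + degree R"
        using deg(2) x(4) by (simp add: P(1) degree_mult_eq degree_power_eq)
      then show False using \<open>f < e\<close> deg(1) by simp
    qed
    then show ?thesis using Q annihilator_dvd_iff by blast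
  qed
  with x show thesis using that by blast
qed

text \<open>
  A linear functional that detects the top power of \<open>u\<close> on \<open>x\<close> gives a pairing of the polynomials with
  \<open>W\<close>; the complement is the orthogonal space of all polynomials, which is stable by construction.
\<close>

lemma exists_stable_complement:
  assumes W: "stable W" "x \<in> W" and P: "annihilator x P" "degree P > 0" "\<And>y. y \<in> W \<Longrightarrow> P \<star> y = 0"
  obtains W' where "stable W'" "direct_sum W (cyclic x) W'"
proof -
  define d where "d = degree P"
  have sW: "subspace W" using W by (simp add: stable_def)
  define bs where "bs = map (\<lambda>j. (u ^^ j) x) [0..<d]"
  have set_bs: "set bs = (\<lambda>j. (u ^^ j) x) ` {..<d}"
    by (auto simp: bs_def atLeast0LessThan[symmetric])
  have "dim (span (set bs)) = length bs"
    using dim_cyclic[OF P(1)] cyclic_eq_span_powers[OF P(1)] set_bs by (simp add: d_def bs_def)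
  then have bs: "distinct bs" "independent (set bs)" using independent_list_iff_dim by blast+
  interpret K: vector_space_pair scale "(*) :: 'a \<Rightarrow> 'a \<Rightarrow> 'a"
    by unfold_locales (simp_all add: algebra_simps)
  \<comment> \<open>The bilinear form \<open>(f, g) \<mapsto> \<phi> (f * g \<star> x)\<close> is anti-triangular with ones on the antidiagonal
    in the basis of powers, hence nondegenerate on the cyclic space.\<close>
  obtain \<phi> where \<phi>: "Vector_Spaces.linear scale (*) \<phi>"
    and \<phi>_bs: "\<And>v. v \<in> set bs \<Longrightarrow> \<phi> v = (if v = (u ^^ (d - 1)) x then 1 else 0)"
    using K.linear_independent_extend[OF bs(2), of "\<lambda>v. if v = (u ^^ (d - 1)) x then 1 else 0"] by blast
  interpret \<phi>: Vector_Spaces.linear scale "(*)" \<phi> by (rule \<phi>)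
  have \<phi>_power: "\<phi> ((u ^^ j) x) = (if j = d - 1 then 1 else 0)" if "j < d" for j
  proof -
    have "(u ^^ j) x = (u ^^ (d - 1)) x \<longleftrightarrow> j = d - 1"
      using nth_eq_iff_index_eq[OF bs(1), of j "d - 1"] that by (simp add: bs_def)
    then show ?thesis using \<phi>_bs that set_bs by auto
  qed
  have \<phi>_act: "\<phi> (Q \<star> y) = (\<Sum>i\<le>degree Q. coeff Q i * \<phi> ((u ^^ i) y))" for Q y
    by (simp add: poly_endo_def \<phi>.sum \<phi>.scale)
  have powers_linear: "(u ^^ j) (y - z) = (u ^^ j) y - (u ^^ j) z" "(u ^^ j) (y + z) = (u ^^ j) y + (u ^^ j) z"
    "(u ^^ j) (c *s y) = c *s (u ^^ j) y" for j y z c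
    using act.diff[of "[:0, 1:] ^ j"] act.add[of "[:0, 1:] ^ j"] act.scale[of "[:0, 1:] ^ j"]
    by (simp_all add: act_power)
  \<comment> \<open>\<open>W'\<close> is the largest stable subspace of \<open>W\<close> on which \<open>\<phi>\<close> vanishes.\<close>
  define W' where "W' = {y \<in> W. \<forall>j. \<phi> ((u ^^ j) y) = 0}"
  have "stable W'"
    unfolding stable_def
  proof (intro conjI ballI)
    show "subspace W'"
      using sW by (auto simp: W'_def subspace_def powers_linear \<phi>.add \<phi>.scale \<phi>.zero act.zero[of "[:0, 1:] ^ _", simplified act_power, simplified])
    show "u y \<in> W'" if "y \<in> W'" for y
    proof -
      have "\<phi> ((u ^^ j) (u y)) = 0" for j
        using that by (metis (mono_tags, lifting) W'_def funpow_Suc_right comp_apply mem_Collect_eq)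
      then show ?thesis using that W(1) by (simp add: W'_def stable_def)
    qed
  qed
  \<comment> \<open>As \<open>P\<close> annihilates \<open>W\<close>, only the powers below \<open>d\<close> matter.\<close>
  have W'I: "y \<in> W'" if y: "y \<in> W" "\<And>j. j < d \<Longrightarrow> \<phi> ((u ^^ j) y) = 0" for y
  proof -
    have "\<phi> ((u ^^ j) y) = 0" for j
    proof -
      define R where "R = ([:0, 1:] ^ j :: 'a poly) mod P"
      have "(u ^^ j) y = (P * ([:0, 1:] ^ j div P) + R) \<star> y"
        by (simp add: R_def act_power)
      also have "\<dots> = R \<star> y" using P(3)[OF y(1)] by (simp add: act_add_left act_mult act_commute[of P])
      finally have "\<phi> ((u ^^ j) y) = (\<Sum>i\<le>degree R. coeff R i * \<phi> ((u ^^ i) y))" by (simp add: \<phi>_act)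
      moreover have "degree R < d"
        using degree_mod_less[OF annihilator_nonzero[OF P(1)], of "[:0, 1:] ^ j"] P(2) by (auto simp: d_def R_def)
      ultimately show ?thesis using y(2) by simp
    qed
    then show ?thesis using y(1) by (simp add: W'_def)
  qed
  \<comment> \<open>Multiply \<open>Q\<close> by the power of \<open>X\<close> that lifts its leading term to degree \<open>d - 1\<close>.\<close>
  have trivial: "y = 0" if y: "y \<in> cyclic x" "y \<in> W'" for y
  proof (rule ccontr)
    assume "y \<noteq> 0"
    obtain Q where Q: "\<forall>i\<ge>d. coeff Q i = 0" "y = Q \<star> x"
      using y(1) unfolding cyclic_eq_span_powers[OF P(1)] in_span_powers_iff d_def by blast
    have "Q \<noteq> 0" using \<open>y \<noteq> 0\<close> Q(2) by auto
    then have deg: "degree Q < d" using Q(1) by (metis leading_coeff_0_iff not_le)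
    define m where "m = degree Q"
    have "(u ^^ (d - 1 - m)) y = Q \<star> (u ^^ (d - 1 - m)) x"
      using act_commute[of Q "[:0, 1:] ^ (d - 1 - m)" x] by (simp add: Q(2) act_power)
    then have "\<phi> ((u ^^ (d - 1 - m)) y) = (\<Sum>i\<le>m. coeff Q i * \<phi> ((u ^^ (i + (d - 1 - m))) x))"
      by (simp add: \<phi>_act m_def funpow_add)
    also have "\<dots> = (\<Sum>i\<le>m. if i = m then coeff Q i else 0)"
      using deg by (intro sum.cong) (auto simp: \<phi>_power m_def)
    also have "\<dots> = lead_coeff Q" by (simp add: m_def)
    finally show False using y(2) \<open>Q \<noteq> 0\<close> by (simp add: W'_def)
  qed
  \<comment> \<open>Modulo the cyclic space, the conditions on \<open>y\<close> are met one after the other: adding a multiple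
    of \<open>t\<close> repairs the condition at \<open>k\<close> and keeps the earlier ones.\<close>
  have approx: "\<exists>z\<in>cyclic x. \<forall>j<k. \<phi> ((u ^^ j) (y - z)) = 0" if "k \<le> d" for k y
    using that
  proof (induction k)
    case 0
    then show ?case by blast
  next
    case (Suc k)
    then obtain z where z: "z \<in> cyclic x" "\<And>j. j < k \<Longrightarrow> \<phi> ((u ^^ j) (y - z)) = 0" by auto
    define c where "c = \<phi> ((u ^^ k) (y - z))"
    define t where "t = (u ^^ (d - 1 - k)) x"
    have t: "\<phi> ((u ^^ j) t) = (if j = k then 1 else 0)" if "j \<le> k" for j
    proof -
      have "(u ^^ j) t = (u ^^ (j + (d - 1 - k))) x" by (simp add: t_def funpow_add)
      then show ?thesis using \<phi>_power[of "j + (d - 1 - k)"] that Suc.prems by auto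
    qed
    have "t \<in> cyclic x" by (rule range_eqI[of _ _ "[:0, 1:] ^ (d - 1 - k)"]) (simp add: t_def act_power)
    then have "z + c *s t \<in> cyclic x"
      using stable_cyclic[of x] z(1) by (auto simp: stable_def intro!: subspace_add subspace_scale)
    moreover have "\<phi> ((u ^^ j) (y - (z + c *s t))) = 0" if "j < Suc k" for j
    proof -
      have "y - (z + c *s t) = (y - z) - c *s t" by simp
      then have "\<phi> ((u ^^ j) (y - (z + c *s t))) = \<phi> ((u ^^ j) (y - z)) - c * \<phi> ((u ^^ j) t)"
        by (simp only: powers_linear \<phi>.diff \<phi>.scale)
      then show ?thesis using t[of j] z(2)[of j] that by (auto simp: c_def less_Suc_eq)
    qed
    ultimately show ?case by blast
  qed
  have "W = {a + b |a b. a \<in> cyclic x \<and> b \<in> W'}"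
  proof (intro equalityI subsetI)
    fix y assume "y \<in> W"
    obtain z where z: "z \<in> cyclic x" "\<forall>j<d. \<phi> ((u ^^ j) (y - z)) = 0" using approx[of d y] by blast
    have "z \<in> W" using z(1) cyclic_subset W by blast
    then have "y - z \<in> W'" using \<open>y \<in> W\<close> sW z(2) by (intro W'I) (auto intro: subspace_diff)
    then have "y = z + (y - z)" "z \<in> cyclic x" "y - z \<in> W'" using z by simp_all
    then show "y \<in> {a + b |a b. a \<in> cyclic x \<and> b \<in> W'}" by blast
  next
    fix y assume "y \<in> {a + b |a b. a \<in> cyclic x \<and> b \<in> W'}"
    then obtain a b where "y = a + b" "a \<in> cyclic x" "b \<in> W'" by blast
    then show "y \<in> W" using cyclic_subset[OF W] sW by (auto simp: W'_def intro!: subspace_add)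
  qed
  moreover have "cyclic x \<inter> W' = {0}"
    using trivial \<open>stable W'\<close> stable_cyclic[of x] subspace_0 unfolding stable_def by blast
  ultimately show thesis using that \<open>stable W'\<close> by (simp add: direct_sum_def)
qed

text \<open>
  \<open>W\<close> is an iterated direct sum of cyclic subspaces with the annihilators \<open>Ps\<close>. The
  conditions that make \<open>Ps\<close> the list of invariant factors, divisibility and monicity, are kept apart
  from it, and the generators are existentially quantified because only the annihilators matter.
\<close>

primrec cyclic_decomp :: "'b set \<Rightarrow> 'a poly list \<Rightarrow> bool" where
  "cyclic_decomp W [] \<longleftrightarrow> W = {0}"
| "cyclic_decomp W (P # Ps) \<longleftrightarrow>
    (\<exists>x W'. annihilator x P \<and> stable W' \<and> direct_sum W (cyclic x) W' \<and> cyclic_decomp W' Ps)"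

lemma cyclic_decomp_dvd:
  assumes "cyclic_decomp W Ps" "P \<in> set Ps" "\<And>y. y \<in> W \<Longrightarrow> R \<star> y = 0"
  shows "P dvd R"
  using assms
proof (induction Ps arbitrary: W)
  case Nil
  then show ?case by simp
next
  case (Cons Q Ps)
  then obtain x W' where x: "annihilator x Q" "stable W'" "direct_sum W (cyclic x) W'" "cyclic_decomp W' Ps"
    by auto
  have sub: "cyclic x \<subseteq> W" "W' \<subseteq> W" using direct_sum_subset[OF stable_cyclic x(2,3)] by auto
  have "1 \<star> x \<in> cyclic x" by blast
  then have "R \<star> x = 0" using sub(1) Cons.prems(3) by auto
  then have "Q dvd R" using x(1) annihilator_dvd_iff by blast
  moreover have "P dvd R" if "P \<in> set Ps"
    using Cons.IH[OF x(4) that] Cons.prems(3) sub(2) by blast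
  ultimately show ?case using Cons.prems(2) by auto
qed

text \<open>
  The kernel of \<open>R(u)\<close> splits along the summands, and on \<open>K[X] / P\<close> it is isomorphic to \<open>K[X] / gcd P R\<close>.
\<close>

lemma cyclic_decomp_dim_kernel:
  assumes "cyclic_decomp W Ps"
  shows "dim {y \<in> W. R \<star> y = 0} = (\<Sum>P\<leftarrow>Ps. degree (pgcd P R))"
  using assms
proof (induction Ps arbitrary: W)
  case Nil
  then have "{y \<in> W. R \<star> y = 0} \<subseteq> {0}" by auto
  then have "dim {y \<in> W. R \<star> y = 0} = 0" by (rule dim_eq_0[THEN iffD2])
  then show ?case by simp
next
  case (Cons P Ps)
  then obtain x W' where x: "annihilator x P" "stable W'" "direct_sum W (cyclic x) W'" "cyclic_decomp W' Ps"
    by auto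
  have "dim {y \<in> W. R \<star> y = 0} = dim {y \<in> cyclic x. R \<star> y = 0} + dim {y \<in> W'. R \<star> y = 0}"
    using stable_kernel[OF stable_cyclic[of x], of R] stable_kernel[OF x(2), of R] direct_sum_kernel[OF stable_cyclic x(2,3), of R]
    by (intro dim_direct_sum) (simp_all add: stable_def)
  then show ?case using dim_kernel_cyclic[OF x(1)] Cons.IH[OF x(4)] by simp
qed

text \<open>
  Split off the cyclic space of a vector whose annihilator kills all of \<open>W\<close>; this makes the later
  annihilators divide the earlier ones.
\<close>

lemma cyclic_decomp_exists:
  assumes "stable W"
  obtains Ps where "cyclic_decomp W Ps" "sorted_wrt (\<lambda>P Q. Q dvd P) Ps" "\<forall>P\<in>set Ps. lead_coeff P = 1 \<and> degree P > 0"
proof -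
  have "\<exists>Ps. cyclic_decomp W Ps \<and> sorted_wrt (\<lambda>P Q. Q dvd P) Ps \<and> (\<forall>P\<in>set Ps. lead_coeff P = 1 \<and> degree P > 0)"
    using assms
  proof (induction "dim W" arbitrary: W rule: less_induct)
    case less
    show ?case
    proof (cases "W = {0}")
      case True
      then show ?thesis by (intro exI[of _ "[]"]) simp
    next
      case False
      obtain x P where x: "x \<in> W" "annihilator x P" "lead_coeff P = 1" "\<And>y. y \<in> W \<Longrightarrow> P \<star> y = 0"
        using exists_maximal_annihilator less.prems by blast
      have "degree P > 0"
      proof (rule ccontr)
        assume "\<not> degree P > 0"
        then have "P = 1" using x(3) by (metis degree_0_id gr0I of_nat_0 of_nat_1 one_pCons)
        then have "W \<subseteq> {0}" using x(4) by auto
        moreover have "0 \<in> W" using less.prems subspace_0 by (simp add: stable_def)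
        ultimately show False using False by blast
      qed
      then obtain W' where W': "stable W'" "direct_sum W (cyclic x) W'"
        using exists_stable_complement[OF less.prems x(1,2)] x(4) by blast
      have "dim W = degree P + dim W'"
        using dim_direct_sum[of "cyclic x" W' W] W' stable_cyclic[of x] dim_cyclic[OF x(2)] by (simp add: stable_def)
      then have "dim W' < dim W" using \<open>degree P > 0\<close> by simp
      then obtain Ps where Ps: "cyclic_decomp W' Ps" "sorted_wrt (\<lambda>P Q. Q dvd P) Ps"
        "\<forall>P\<in>set Ps. lead_coeff P = 1 \<and> degree P > 0"
        using less.hyps W'(1) by blast
      have "Q dvd P" if "Q \<in> set Ps" for Q
        using cyclic_decomp_dvd[OF Ps(1) that] x(4) direct_sum_subset(2)[OF stable_cyclic W'] by blast
      then show ?thesis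
        using Ps x(2,3) W' \<open>degree P > 0\<close> by (intro exI[of _ "P # Ps"]) auto
    qed
  qed
  then show thesis using that by blast
qed

end

section \<open>Companion matrices and elementary factors\<close>

lemma sum_lessThan_add:
  fixes f :: "nat \<Rightarrow> 'c::comm_monoid_add"
  shows "(\<Sum>i<m + n. f i) = (\<Sum>i<m. f i) + (\<Sum>i<n. f (m + i))"
  by (induction n) (simp_all add: add.assoc)

context endomorphism
begin

lemma represented_on_iff:
  "represented_on scale W u A \<longleftrightarrow> (\<exists>bs. span (set bs) = W \<and> dim W = length bs \<and>
     A \<in> carrier_mat (length bs) (length bs) \<and>
     (\<forall>j<length bs. u (bs ! j) = (\<Sum>i<length bs. A $$ (i, j) *s bs ! i)))"
proof -
  have "distinct bs \<and> independent (set bs) \<and> span (set bs) = W \<and> R \<longleftrightarrow>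
      span (set bs) = W \<and> dim W = length bs \<and> R" for bs R
    using independent_list_iff_dim[of bs] by blast
  then show ?thesis unfolding represented_on_def by simp
qed

lemma represented_on_stable:
  assumes "represented_on scale W u A"
  shows "stable W"
proof -
  obtain bs where bs: "span (set bs) = W"
    "\<And>j. j < length bs \<Longrightarrow> u (bs ! j) = (\<Sum>i<length bs. A $$ (i, j) *s bs ! i)"
    using assms unfolding represented_on_iff by blast
  have "span (set bs) \<subseteq> {x. u x \<in> W}"
  proof (rule span_minimal)
    show "set bs \<subseteq> {x. u x \<in> W}"
    proof
      fix b assume "b \<in> set bs"
      then obtain j where "j < length bs" "b = bs ! j" by (auto simp: in_set_conv_nth)
      then show "b \<in> {x. u x \<in> W}"
        unfolding bs(1)[symmetric] by (simp add: bs(2)) (intro span_sum span_scale span_base, simp)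
    qed
    show "subspace {x. u x \<in> W}"
      unfolding bs(1)[symmetric] by (rule u.subspace_linear_preimage) simp
  qed
  then show ?thesis using bs(1) by (auto simp: stable_def)
qed

text \<open>
  A block-diagonal matrix splits the basis, hence the space; intersections are controlled by counting
  dimensions.
\<close>

lemma represented_on_four_block:
  assumes A: "A \<in> carrier_mat m m" and B: "B \<in> carrier_mat n n"
  shows "represented_on scale W u (four_block_mat A (0\<^sub>m m n) (0\<^sub>m n m) B) \<longleftrightarrow>
    (\<exists>W1 W2. direct_sum W W1 W2 \<and> represented_on scale W1 u A \<and> represented_on scale W2 u B)"
    (is "represented_on scale W u ?M \<longleftrightarrow> ?R")
proof
  have M: "?M $$ (i, j) = (if i < m then if j < m then A $$ (i, j) else 0 else if j < m then 0 else B $$ (i - m, j - m))"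
    if "i < m + n" "j < m + n" for i j
    using that A B by (auto simp: index_mat_four_block)
  have cM: "?M \<in> carrier_mat (m + n) (m + n)" using A B by (rule four_block_carrier_mat)
  show ?R if rep: "represented_on scale W u ?M"
  proof -
    obtain bs where bs: "span (set bs) = W" "dim W = length bs" "?M \<in> carrier_mat (length bs) (length bs)"
      "\<And>j. j < length bs \<Longrightarrow> u (bs ! j) = (\<Sum>i<length bs. ?M $$ (i, j) *s bs ! i)"
      using rep unfolding represented_on_iff by blast
    have len: "length bs = m + n" using carrier_matD(1)[OF bs(3)] carrier_matD(1)[OF cM] by linarith
    define as where "as = take m bs"
    define cs where "cs = drop m bs"
    have abs: "bs = as @ cs" "length as = m" "length cs = n" using len by (auto simp: as_def cs_def)
    have sums: "W = {x + y |x y. x \<in> span (set as) \<and> y \<in> span (set cs)}"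
      using bs(1) span_Un[of "set as" "set cs"] by (simp add: abs(1))
    then have "dim W + dim (span (set as) \<inter> span (set cs)) = dim (span (set as)) + dim (span (set cs))"
      using dim_sums_Int[of "span (set as)" "span (set cs)"] by simp
    moreover have "dim (span (set as)) \<le> m" "dim (span (set cs)) \<le> n"
      using dim_le_card'[of "set as"] dim_le_card'[of "set cs"] card_length[of as] card_length[of cs] abs by simp_all
    ultimately have dims: "dim (span (set as)) = m" "dim (span (set cs)) = n"
      "dim (span (set as) \<inter> span (set cs)) = 0"
      using bs(2) len by linarith+
    have "span (set as) \<inter> span (set cs) = {0}"
      using dims(3)[unfolded dim_eq_0] span_zero by blast
    then have "direct_sum W (span (set as)) (span (set cs))" using sums by (simp add: direct_sum_def)
    moreover have "represented_on scale (span (set as)) u A"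
      unfolding represented_on_iff
    proof (intro exI[of _ as] conjI allI impI)
      fix j assume j: "j < length as"
      have "u (as ! j) = (\<Sum>i<m + n. ?M $$ (i, j) *s bs ! i)"
        using bs(4)[of j] j abs len by (simp add: nth_append)
      also have "\<dots> = (\<Sum>i<length as. A $$ (i, j) *s as ! i)"
        using j abs by (simp add: sum_lessThan_add M nth_append)
      finally show "u (as ! j) = (\<Sum>i<length as. A $$ (i, j) *s as ! i)" .
    qed (use abs A dims in auto)
    moreover have "represented_on scale (span (set cs)) u B"
      unfolding represented_on_iff
    proof (intro exI[of _ cs] conjI allI impI)
      fix j assume j: "j < length cs"
      have "u (cs ! j) = (\<Sum>i<m + n. ?M $$ (i, m + j) *s bs ! i)"
        using bs(4)[of "m + j"] j abs len by (simp add: nth_append)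
      also have "\<dots> = (\<Sum>i<length cs. B $$ (i, j) *s cs ! i)"
        using j abs by (simp add: sum_lessThan_add M nth_append)
      finally show "u (cs ! j) = (\<Sum>i<length cs. B $$ (i, j) *s cs ! i)" .
    qed (use abs B dims in auto)
    ultimately show ?R by blast
  qed
  show "represented_on scale W u ?M" if ?R
  proof -
    obtain W1 W2 where W: "direct_sum W W1 W2" "represented_on scale W1 u A" "represented_on scale W2 u B"
      using \<open>?R\<close> by blast
    obtain as where as: "span (set as) = W1" "dim W1 = length as" "A \<in> carrier_mat (length as) (length as)"
      "\<And>j. j < length as \<Longrightarrow> u (as ! j) = (\<Sum>i<length as. A $$ (i, j) *s as ! i)"
      using W(2) unfolding represented_on_iff by blast
    obtain cs where cs: "span (set cs) = W2" "dim W2 = length cs" "B \<in> carrier_mat (length cs) (length cs)"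
      "\<And>j. j < length cs \<Longrightarrow> u (cs ! j) = (\<Sum>i<length cs. B $$ (i, j) *s cs ! i)"
      using W(3) unfolding represented_on_iff by blast
    have len: "length as = m" "length cs = n" using as(3) cs(3) A B by auto
    have sub: "subspace W1" "subspace W2" using as(1) cs(1) by auto
    show ?thesis
      unfolding represented_on_iff
    proof (intro exI[of _ "as @ cs"] conjI allI impI)
      show "span (set (as @ cs)) = W"
        using W(1) as(1) cs(1) by (simp add: span_Un direct_sum_def)
      show "dim W = length (as @ cs)"
        using dim_direct_sum[OF sub W(1)] as(2) cs(2) by simp
      show "?M \<in> carrier_mat (length (as @ cs)) (length (as @ cs))" using cM len by simp
      fix j assume j: "j < length (as @ cs)"
      show "u ((as @ cs) ! j) = (\<Sum>i<length (as @ cs). ?M $$ (i, j) *s (as @ cs) ! i)"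
      proof (cases "j < m")
        case True
        then show ?thesis using as(4)[of j] len by (simp add: sum_lessThan_add M nth_append)
      next
        case False
        then show ?thesis using cs(4)[of "j - m"] j len by (simp add: sum_lessThan_add M nth_append)
      qed
    qed
  qed
qed

lemma represented_on_companion:
  assumes P: "lead_coeff P = 1" "degree P > 0"
  shows "represented_on scale W u (companion_mat P) \<longleftrightarrow> (\<exists>x. annihilator x P \<and> W = cyclic x)"
proof
  define d where "d = degree P"
  have "d > 0" using P by (simp add: d_def)
  have act_P: "P \<star> x = (\<Sum>i<d. coeff P i *s (u ^^ i) x) + (u ^^ d) x" for x
  proof -
    have "P \<star> x = (\<Sum>i<Suc d. coeff P i *s (u ^^ i) x)"
      by (rule act_eq_sum) (simp add: coeff_eq_0 d_def)
    then show ?thesis using P(1) by (simp add: d_def)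
  qed
  have inner: "(\<Sum>i<d. companion_mat P $$ (i, j) *s b i) = b (Suc j)" if "Suc j < d" for j b
  proof -
    have "(\<Sum>i<d. companion_mat P $$ (i, j) *s b i) = (\<Sum>i<d. if i = Suc j then b i else 0)"
      using that by (intro sum.cong) (auto simp: companion_mat_def d_def)
    then show ?thesis using that by simp
  qed
  have last: "(\<Sum>i<d. companion_mat P $$ (i, j) *s b i) = - (\<Sum>i<d. coeff P i *s b i)" if "Suc j = d" for j b
    using that by (simp add: companion_mat_def d_def sum_negf[symmetric])
  {
    assume "\<exists>x. annihilator x P \<and> W = cyclic x"
    then obtain x where x: "annihilator x P" "W = cyclic x" by blast
    define bs where "bs = map (\<lambda>j. (u ^^ j) x) [0..<d]"
    have set_bs: "set bs = (\<lambda>j. (u ^^ j) x) ` {..<d}"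
      by (auto simp: bs_def atLeast0LessThan[symmetric])
    show "represented_on scale W u (companion_mat P)"
      unfolding represented_on_iff
    proof (intro exI[of _ bs] conjI allI impI)
      show "span (set bs) = W" using cyclic_eq_span_powers[OF x(1)] by (simp add: x(2) set_bs d_def)
      show "dim W = length bs" using dim_cyclic[OF x(1)] by (simp add: x(2) bs_def d_def)
      show "companion_mat P \<in> carrier_mat (length bs) (length bs)"
        by (simp add: companion_mat_def bs_def d_def)
      fix j assume "j < length bs"
      then have j: "j < d" by (simp add: bs_def)
      have "(\<Sum>i<d. coeff P i *s (u ^^ i) x) + (u ^^ d) x = 0"
        using annihilator_dvd_iff[OF x(1), of P] act_P[of x] by simp
      then have "(u ^^ d) x = - (\<Sum>i<d. coeff P i *s (u ^^ i) x)" by (simp add: eq_neg_iff_add_eq_0 add.commute)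
      then have "(\<Sum>i<d. companion_mat P $$ (i, j) *s (u ^^ i) x) = (u ^^ Suc j) x"
        using inner[of j "\<lambda>i. (u ^^ i) x"] last[of j "\<lambda>i. (u ^^ i) x"] j by (cases "Suc j = d") auto
      moreover have "(\<Sum>i<length bs. companion_mat P $$ (i, j) *s bs ! i) = (\<Sum>i<d. companion_mat P $$ (i, j) *s (u ^^ i) x)"
        by (rule sum.cong) (simp_all add: bs_def)
      ultimately show "u (bs ! j) = (\<Sum>i<length bs. companion_mat P $$ (i, j) *s bs ! i)"
        using j by (simp add: bs_def)
    qed
  next
    assume "represented_on scale W u (companion_mat P)"
    then have "stable W" by (rule represented_on_stable)
    from \<open>represented_on scale W u (companion_mat P)\<close>
    obtain bs where bs: "span (set bs) = W" "dim W = length bs" "companion_mat P \<in> carrier_mat (length bs) (length bs)"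
      "\<And>j. j < length bs \<Longrightarrow> u (bs ! j) = (\<Sum>i<length bs. companion_mat P $$ (i, j) *s bs ! i)"
      unfolding represented_on_iff by blast
    have len: "length bs = d" using bs(3) by (auto simp: companion_mat_def d_def)
    define x where "x = bs ! 0"
    \<comment> \<open>By the columns of the companion matrix except the last, the basis consists of the powers of
      \<open>u\<close> on its first vector; the last column says that \<open>P\<close> annihilates that vector.\<close>
    have pow: "(u ^^ j) x = bs ! j" if "j < d" for j
      using that
    proof (induction j)
      case (Suc j)
      then show ?case using bs(4)[of j] inner[of j "\<lambda>i. bs ! i"] len by simp
    qed (simp add: x_def)
    have "(u ^^ d) x = u ((u ^^ (d - 1)) x)" using \<open>d > 0\<close> by (cases d) auto
    also have "\<dots> = - (\<Sum>i<d. coeff P i *s bs ! i)"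
      using bs(4)[of "d - 1"] last[of "d - 1" "\<lambda>i. bs ! i"] len \<open>d > 0\<close> by (simp add: pow)
    finally have "P \<star> x = 0" by (simp add: act_P pow)
    obtain A where A: "annihilator x A" by (rule annihilator_exists)
    then have "A dvd P" using \<open>P \<star> x = 0\<close> annihilator_dvd_iff by blast
    \<comment> \<open>Comparing dimensions, no proper divisor of \<open>P\<close> annihilates \<open>x\<close>.\<close>
    have "set bs \<subseteq> cyclic x"
    proof
      fix b assume "b \<in> set bs"
      then obtain j where "j < d" "b = bs ! j" using len by (auto simp: in_set_conv_nth)
      then have "b = ([:0, 1:] ^ j) \<star> x" by (simp add: pow[symmetric] act_power)
      then show "b \<in> cyclic x" by blast
    qed
    then have "W \<subseteq> cyclic x"
      using bs(1) span_minimal stable_cyclic[of x] by (metis stable_def)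
    moreover have "x \<in> W" using bs(1) len \<open>d > 0\<close> by (auto simp: x_def intro!: span_base)
    ultimately have W: "W = cyclic x" using cyclic_subset[OF \<open>stable W\<close>] by blast
    then have "degree A = degree P" using dim_cyclic[OF A] bs(2) len by (simp add: d_def)
    obtain C where C: "P = A * C" using \<open>A dvd P\<close> by (elim dvdE)
    have "P \<noteq> 0" using P by auto
    then have "A \<noteq> 0" "C \<noteq> 0" using C by auto
    then have "is_unit C" using \<open>degree A = degree P\<close> by (simp add: C degree_mult_eq is_unit_iff_degree)
    then have "annihilator x P" using A \<open>P \<noteq> 0\<close> unfolding annihilator_def C by (simp add: mult_unit_dvd_iff)
    then show "\<exists>x. annihilator x P \<and> W = cyclic x" using W by blast
  }
qed

text \<open>
  The lists are reversed because a cyclic decomposition starts with the largest invariant factor, while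
  the elementary factors are listed from the smallest one.
\<close>

lemma cyclic_decomp_iff_represented_on:
  assumes "\<forall>P\<in>set Ps. lead_coeff P = 1 \<and> degree P > 0"
  shows "cyclic_decomp W Ps \<longleftrightarrow> represented_on scale W u (diag_block_mat (map companion_mat (rev Ps)))"
  using assms
proof (induction Ps arbitrary: W)
  case Nil
  have "represented_on scale W u (0\<^sub>m 0 0) \<longleftrightarrow> W = {0}"
    unfolding represented_on_iff by auto
  then show ?case by simp
next
  case (Cons P Ps)
  let ?D = "diag_block_mat (map companion_mat (rev Ps))"
  define m where "m = dim_row ?D"
  have D: "?D \<in> carrier_mat m m"
    unfolding m_def carrier_mat_def by (simp add: dim_diag_block_mat companion_mat_def comp_def)
  have C: "companion_mat P \<in> carrier_mat (degree P) (degree P)" by (simp add: companion_mat_def)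
  have "diag_block_mat (map companion_mat (rev (P # Ps)))
      = four_block_mat ?D (0\<^sub>m m (degree P)) (0\<^sub>m (degree P) m) (companion_mat P)"
    using D C by (simp add: diag_block_mat_last Let_def)
  moreover have "represented_on scale W u (four_block_mat ?D (0\<^sub>m m (degree P)) (0\<^sub>m (degree P) m) (companion_mat P))
      \<longleftrightarrow> (\<exists>W' Z. direct_sum W W' Z \<and> represented_on scale W' u ?D \<and> represented_on scale Z u (companion_mat P))"
    by (rule represented_on_four_block[OF D C])
  moreover have "\<dots> \<longleftrightarrow> (\<exists>W' Z. direct_sum W W' Z \<and> represented_on scale W' u ?D \<and> (\<exists>x. annihilator x P \<and> Z = cyclic x))"
    using represented_on_companion[of P] Cons.prems by simp
  moreover have "\<dots> \<longleftrightarrow> cyclic_decomp W (P # Ps)"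
    unfolding cyclic_decomp.simps direct_sum_commute[of W "cyclic _"]
    using represented_on_stable Cons by (metis list.set_intros(2))
  ultimately show ?case by simp
qed

text \<open>
  The definite description is resolved by the existence of a cyclic decomposition and the uniqueness of
  its invariant factors; the remaining development only uses cyclic decompositions.
\<close>

lemma elementary_factors_cyclic_decomp:
  assumes "stable W"
  shows "cyclic_decomp W (rev (elementary_factors scale W u))"
    and "sorted_wrt (\<lambda>P Q. Q dvd P) (rev (elementary_factors scale W u))"
    and "\<forall>P\<in>set (elementary_factors scale W u). lead_coeff P = 1 \<and> degree P > 0"
proof -
  obtain Ps where Ps: "cyclic_decomp W Ps" "sorted_wrt (\<lambda>P Q. Q dvd P) Ps" "\<forall>P\<in>set Ps. lead_coeff P = 1 \<and> degree P > 0"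
    using cyclic_decomp_exists[OF assms] by blast
  have "elementary_factors scale W u = rev Ps"
    unfolding elementary_factors_def
  proof (rule the_equality)
    show "(\<forall>P\<in>set (rev Ps). lead_coeff P = 1 \<and> 0 < degree P) \<and> sorted_wrt (dvd) (rev Ps) \<and>
      represented_on scale W u (diag_block_mat (map companion_mat (rev Ps)))"
      using Ps cyclic_decomp_iff_represented_on by (simp add: sorted_wrt_rev)
  next
    fix Qs assume Qs: "(\<forall>P\<in>set Qs. lead_coeff P = 1 \<and> 0 < degree P) \<and> sorted_wrt (dvd) Qs \<and>
      represented_on scale W u (diag_block_mat (map companion_mat Qs))"
    then have "cyclic_decomp W (rev Qs)" using cyclic_decomp_iff_represented_on[of "rev Qs"] by simp
    then have "rev Qs = Ps"
      using Ps Qs cyclic_decomp_dim_kernel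
      by (intro divisor_chain_unique) (simp_all add: sorted_wrt_rev cyclic_decomp_dim_kernel[symmetric])
    then show "Qs = rev Ps" by auto
  qed
  then show "cyclic_decomp W (rev (elementary_factors scale W u))"
    "sorted_wrt (\<lambda>P Q. Q dvd P) (rev (elementary_factors scale W u))"
    "\<forall>P\<in>set (elementary_factors scale W u). lead_coeff P = 1 \<and> degree P > 0"
    using Ps by simp_all
qed

end

section \<open>Minimal polynomial and rootless part\<close>

lemma coprime_linear_prod:
  fixes Q :: "'a::field poly"
  assumes "\<forall>c\<in>set cs. poly Q c \<noteq> 0"
  shows "coprime Q (prod_list (map (\<lambda>c. [:- c, 1:]) cs))"
  using assms by (induction cs) (auto intro!: coprime_poly_mult_right simp: coprime_linear_iff simp del: mult_pCons_left)

lemma lead_coeff_linear_prod: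
  "lead_coeff (prod_list (map (\<lambda>c. [:- c, 1:]) cs) :: 'a::field poly) = 1"
  by (induction cs) (simp_all add: lead_coeff_mult del: mult_pCons_left)

lemma rootless_factorization:
  fixes \<mu> :: "'a::field poly"
  assumes "\<mu> \<noteq> 0"
  shows "\<exists>cs Q. set cs \<subseteq> \<Lambda> \<and> \<mu> = prod_list (map (\<lambda>c. [:- c, 1:]) cs) * Q \<and> (\<forall>c\<in>\<Lambda>. poly Q c \<noteq> 0)"
  using assms
proof (induction "degree \<mu>" arbitrary: \<mu> rule: less_induct)
  case less
  show ?case
  proof (cases "\<exists>c\<in>\<Lambda>. poly \<mu> c = 0")
    case False
    then show ?thesis by (intro exI[of _ "[]"] exI[of _ \<mu>]) auto
  next
    case True
    then obtain c where c: "c \<in> \<Lambda>" "poly \<mu> c = 0" by blast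
    then obtain \<nu> where \<nu>: "\<mu> = [:- c, 1:] * \<nu>" by (auto simp: poly_eq_0_iff_dvd elim: dvdE)
    then have "\<nu> \<noteq> 0" using less.prems by auto
    then have "degree \<nu> < degree \<mu>" unfolding \<nu> by (subst degree_mult_eq) auto
    then obtain cs Q where "set cs \<subseteq> \<Lambda>" "\<nu> = prod_list (map (\<lambda>c. [:- c, 1:]) cs) * Q" "\<forall>c\<in>\<Lambda>. poly Q c \<noteq> 0"
      using less.hyps \<open>\<nu> \<noteq> 0\<close> by blast
    then show ?thesis using c(1) \<nu>
      by (intro exI[of _ "c # cs"] exI[of _ Q]) (simp add: mult.assoc del: mult_pCons_left)
  qed
qed

text \<open>
  Uniqueness: a factor without root in \<open>\<Lambda>\<close> is coprime to every product of \<open>X - c\<close> with \<open>c \<in> \<Lambda>\<close>, so two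
  candidates divide each other.
\<close>

lemma rootless_part:
  fixes \<mu> :: "'a::field poly"
  assumes "lead_coeff \<mu> = 1"
  obtains cs where "set cs \<subseteq> \<Lambda>" "\<mu> = prod_list (map (\<lambda>c. [:- c, 1:]) cs) * rootless_part \<Lambda> \<mu>"
    and "\<forall>c\<in>\<Lambda>. poly (rootless_part \<Lambda> \<mu>) c \<noteq> 0"
proof -
  let ?prod = "\<lambda>cs. prod_list (map (\<lambda>c. [:- c, 1:]) cs) :: 'a poly"
  let ?is = "\<lambda>Q. lead_coeff Q = 1 \<and> (\<forall>c\<in>\<Lambda>. poly Q c \<noteq> 0) \<and> (\<exists>cs. set cs \<subseteq> \<Lambda> \<and> \<mu> = ?prod cs * Q)"
  have "\<exists>!Q. ?is Q"
  proof (rule ex_ex1I)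
    have "\<mu> \<noteq> 0" using assms by auto
    then obtain cs Q where Q: "set cs \<subseteq> \<Lambda>" "\<mu> = ?prod cs * Q" "\<forall>c\<in>\<Lambda>. poly Q c \<noteq> 0"
      using rootless_factorization by blast
    then have "lead_coeff Q = 1" using assms lead_coeff_linear_prod[of cs] by (simp add: lead_coeff_mult)
    with Q show "\<exists>Q. ?is Q" by blast
  next
    have dvd: "Q dvd Q'" if Q: "?is Q" and Q': "?is Q'" for Q Q'
    proof -
      obtain cs where "\<mu> = ?prod cs * Q" using Q by blast
      then have "Q dvd \<mu>" by simp
      moreover obtain cs' where cs': "set cs' \<subseteq> \<Lambda>" "\<mu> = ?prod cs' * Q'" using Q' by blast
      moreover have "coprime Q (?prod cs')" using Q cs'(1) by (intro coprime_linear_prod) blast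
      ultimately show "Q dvd Q'" by (metis coprime_poly_dvd_cancel)
    qed
    show "Q = Q'" if "?is Q" "?is Q'" for Q Q'
      using dvd[OF that] dvd[OF that(2,1)] that by (intro monic_dvd_antisym) blast+
  qed
  then have "?is (rootless_part \<Lambda> \<mu>)" unfolding rootless_part_def by (rule theI')
  then show thesis using that by blast
qed

context endomorphism
begin

text \<open>
  A vector whose annihilator kills the whole space has the minimal polynomial as its annihilator.
\<close>

lemma min_poly:
  "lead_coeff (min_poly scale u) = 1" "(\<forall>x. P \<star> x = 0) \<longleftrightarrow> min_poly scale u dvd P"
proof -
  obtain x \<mu> where "x \<in> UNIV" "annihilator x \<mu>" "lead_coeff \<mu> = 1" "\<And>y. y \<in> UNIV \<Longrightarrow> \<mu> \<star> y = 0"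
    by (rule exists_maximal_annihilator[OF stable_UNIV]) blast
  then have \<mu>: "annihilator x \<mu>" "lead_coeff \<mu> = 1" "\<And>y. \<mu> \<star> y = 0" by auto
  have *: "lead_coeff \<mu> = 1 \<and> (\<forall>P. (\<forall>x. P \<star> x = 0) \<longleftrightarrow> \<mu> dvd P)"
    using \<mu> annihilator_dvd_iff[OF \<mu>(1)] act_eq_0_dvd by blast
  have "min_poly scale u = \<mu>"
    unfolding min_poly_def
  proof (rule the_equality, rule *)
    fix \<nu> assume "lead_coeff \<nu> = 1 \<and> (\<forall>P. (\<forall>x. P \<star> x = 0) \<longleftrightarrow> \<nu> dvd P)"
    then show "\<nu> = \<mu>" using * by (intro monic_dvd_antisym) auto
  qed
  then show "lead_coeff (min_poly scale u) = 1" "(\<forall>x. P \<star> x = 0) \<longleftrightarrow> min_poly scale u dvd P"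
    using * by auto
qed

lemma rootless_space_eq: "rootless_space scale u \<Lambda> = {x \<in> UNIV. rootless_part \<Lambda> (min_poly scale u) \<star> x = 0}"
  by (simp add: rootless_space_def)

lemma stable_rootless_space: "stable (rootless_space scale u \<Lambda>)"
  unfolding rootless_space_eq by (rule stable_kernel[OF stable_UNIV])

lemma rootless_part_nonroot: "c \<in> \<Lambda> \<Longrightarrow> poly (rootless_part \<Lambda> (min_poly scale u)) c \<noteq> 0"
  using rootless_part[OF min_poly(1)] by metis

lemma rootless_dvd:
  assumes "R dvd min_poly scale u" "\<And>c. c \<in> \<Lambda> \<Longrightarrow> poly R c \<noteq> 0"
  shows "R dvd rootless_part \<Lambda> (min_poly scale u)"
proof -
  obtain cs where cs: "set cs \<subseteq> \<Lambda>"
    "min_poly scale u = prod_list (map (\<lambda>c. [:- c, 1:]) cs) * rootless_part \<Lambda> (min_poly scale u)"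
    using rootless_part[OF min_poly(1)] by metis
  have "coprime R (prod_list (map (\<lambda>c. [:- c, 1:]) cs))"
    using cs(1) assms(2) by (intro coprime_linear_prod) blast
  then show ?thesis using assms(1) cs(2) by (metis coprime_poly_dvd_cancel)
qed

text \<open>
  The annihilator of such a vector divides the minimal polynomial and has no root in \<open>\<Lambda>\<close>.
\<close>

lemma in_rootless_space:
  assumes "R \<star> x = 0" "\<And>c. c \<in> \<Lambda> \<Longrightarrow> poly R c \<noteq> 0"
  shows "x \<in> rootless_space scale u \<Lambda>"
proof -
  obtain P where P: "annihilator x P" by (rule annihilator_exists)
  have "min_poly scale u \<star> x = 0" using min_poly(2)[of "min_poly scale u"] by simp
  then have "P dvd min_poly scale u" by (rule annihilator_dvd_iff[OF P, THEN iffD1])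
  moreover have "P dvd R" using assms(1) annihilator_dvd_iff[OF P] by simp
  then have "poly P c \<noteq> 0" if "c \<in> \<Lambda>" for c
    using assms(2)[OF that] by (auto elim: dvdE)
  ultimately have "P dvd rootless_part \<Lambda> (min_poly scale u)" by (intro rootless_dvd)
  then show ?thesis using P by (simp add: rootless_space_eq annihilator_dvd_iff)
qed

end

section \<open>Reflection of polynomials\<close>

text \<open>
  The substitution \<open>X \<mapsto> 2 * \<alpha> - X\<close>, an involution of the polynomial ring that fixes \<open>X - \<alpha>\<close> up to sign.
\<close>

definition reflect :: "'a::field \<Rightarrow> 'a poly \<Rightarrow> 'a poly" where
  "reflect \<alpha> P = pcompose P [:2 * \<alpha>, - 1:]"

lemma reflect_mult: "reflect \<alpha> (P * Q) = reflect \<alpha> P * reflect \<alpha> Q"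
  by (simp add: reflect_def pcompose_mult)

lemma reflect_add: "reflect \<alpha> (P + Q) = reflect \<alpha> P + reflect \<alpha> Q"
  by (simp add: reflect_def pcompose_add)

lemma reflect_diff: "reflect \<alpha> (P - Q) = reflect \<alpha> P - reflect \<alpha> Q"
  by (simp add: reflect_def pcompose_diff)

lemma reflect_smult: "reflect \<alpha> (Polynomial.smult c P) = Polynomial.smult c (reflect \<alpha> P)"
  by (simp add: reflect_def pcompose_smult)

lemma reflect_power: "reflect \<alpha> (P ^ n) = reflect \<alpha> P ^ n"
  by (induction n) (simp_all add: reflect_mult, simp add: reflect_def pcompose_1)

lemma reflect_const [simp]: "reflect \<alpha> [:c:] = [:c:]"
  by (simp add: reflect_def)

lemma reflect_linear: "reflect \<alpha> [:- c, 1:] = - [:- (2 * \<alpha> - c), 1:]"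
  by (simp add: reflect_def pcompose_pCons)

lemma reflect_reflect [simp]: "reflect \<alpha> (reflect \<alpha> P) = P"
proof -
  have "pcompose [:2 * \<alpha>, - 1:] [:2 * \<alpha>, - 1:] = [:0, 1:]"
    by (simp add: pcompose_pCons)
  then show ?thesis by (simp add: reflect_def pcompose_assoc[symmetric])
qed

lemma poly_reflect: "poly (reflect \<alpha> P) c = poly P (2 * \<alpha> - c)"
  by (simp add: reflect_def poly_pcompose)

lemma degree_reflect [simp]: "degree (reflect \<alpha> P) = degree P"
  by (simp add: reflect_def degree_pcompose)

lemma lead_coeff_reflect: "lead_coeff (reflect \<alpha> P) = (- 1) ^ degree P * lead_coeff P"
  using lead_coeff_comp[of "[:2 * \<alpha>, - 1:]" P] by (simp add: reflect_def)

lemma reflect_dvd_reflect_iff: "reflect \<alpha> P dvd reflect \<alpha> Q \<longleftrightarrow> P dvd Q"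
proof -
  have "reflect \<alpha> A dvd reflect \<alpha> B" if "A dvd B" for A B
    using that by (elim dvdE) (simp add: reflect_mult)
  from this[of P Q] this[of "reflect \<alpha> P" "reflect \<alpha> Q"] show ?thesis by auto
qed

lemma degree_pgcd_reflect: "degree (pgcd (reflect \<alpha> P) R) = degree (pgcd P (reflect \<alpha> R))"
proof -
  have *: "reflect \<alpha> (pgcd (reflect \<alpha> A) B) dvd pgcd A (reflect \<alpha> B)" for A B :: "'a poly"
    using pgcd_dvd(1)[of "reflect \<alpha> A" B] pgcd_dvd(2)[of "reflect \<alpha> A" B]
      reflect_dvd_reflect_iff[of \<alpha> _ "reflect \<alpha> A"]
    by (simp add: dvd_pgcd_iff reflect_dvd_reflect_iff)
  have "pgcd P (reflect \<alpha> R) dvd reflect \<alpha> (pgcd (reflect \<alpha> P) R)"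
  proof -
    have "reflect \<alpha> (pgcd P (reflect \<alpha> R)) dvd reflect \<alpha> P" "reflect \<alpha> (pgcd P (reflect \<alpha> R)) dvd reflect \<alpha> (reflect \<alpha> R)"
      unfolding reflect_dvd_reflect_iff by simp_all
    then have "reflect \<alpha> (pgcd P (reflect \<alpha> R)) dvd pgcd (reflect \<alpha> P) R"
      by (simp add: dvd_pgcd_iff)
    then show ?thesis using reflect_dvd_reflect_iff[of \<alpha> "reflect \<alpha> (pgcd P (reflect \<alpha> R))"] by simp
  qed
  then show ?thesis using degree_eq_of_mutual_dvd[OF *[of P R]] by simp
qed

lemma even_polynomial:
  fixes T :: "'a::field poly"
  assumes "\<And>i. odd i \<Longrightarrow> coeff T i = 0"
  obtains S where "T = pcompose S [:0, 0, 1:]"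
proof -
  have "\<exists>S. T = pcompose S [:0, 0, 1:]"
    using assms
  proof (induction "degree T" arbitrary: T rule: less_induct)
    case less
    obtain a T1 where T1: "T = pCons a T1" by (cases T)
    obtain b T2 where T2: "T1 = pCons b T2" by (cases T1)
    have "b = 0" using less.prems[of 1] by (simp add: T1 T2)
    have odd: "coeff T2 i = 0" if "odd i" for i
      using less.prems[of "i + 2"] that by (simp add: T1 T2)
    have "\<exists>S. T2 = pcompose S [:0, 0, 1:]"
    proof (cases "T2 = 0")
      case True
      then show ?thesis by (intro exI[of _ 0]) simp
    next
      case False
      then have "degree T2 < degree T" by (simp add: T1 T2)
      then show ?thesis using less.hyps odd by blast
    qed
    then obtain S where "T2 = pcompose S [:0, 0, 1:]" by blast
    then have "T = pcompose (pCons a S) [:0, 0, 1:]"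
      using \<open>b = 0\<close> by (simp add: T1 T2 pcompose_pCons)
    then show ?case by blast
  qed
  then show thesis using that by blast
qed

text \<open>
  A polynomial is invariant under \<open>X \<mapsto> - X\<close> if and only if its odd coefficients vanish, since \<open>2\<close> is
  invertible.
\<close>

lemma polynomial_of_iff_reflect:
  fixes P :: "'a::field poly"
  assumes "(2 :: 'a) \<noteq> 0"
  shows "polynomial_of ([:- \<alpha>, 1:] ^ 2) P \<longleftrightarrow> reflect \<alpha> P = P"
proof
  assume "polynomial_of ([:- \<alpha>, 1:] ^ 2) P"
  then obtain S where S: "P = pcompose S ([:- \<alpha>, 1:] ^ 2)" by (auto simp: polynomial_of_def)
  have "reflect \<alpha> ([:- \<alpha>, 1:] ^ 2) = [:- \<alpha>, 1:] ^ 2"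
    by (simp only: power2_eq_square reflect_mult reflect_linear) simp
  then show "reflect \<alpha> P = P" by (simp add: S reflect_def pcompose_assoc[symmetric])
next
  assume refl: "reflect \<alpha> P = P"
  \<comment> \<open>After translating \<open>\<alpha>\<close> to \<open>0\<close>, the reflection is \<open>X \<mapsto> - X\<close>.\<close>
  define T where "T = pcompose P [:\<alpha>, 1:]"
  have "pcompose T [:0, - 1:] = pcompose P [:\<alpha>, - 1:]"
    by (simp add: T_def pcompose_assoc[symmetric] pcompose_pCons)
  also have "\<dots> = pcompose (reflect \<alpha> P) [:\<alpha>, 1:]"
    by (simp add: reflect_def pcompose_assoc[symmetric] pcompose_pCons)
  finally have "pcompose T [:0, - 1:] = T" using refl by (simp add: T_def)
  then have "(- 1) ^ i * coeff T i = coeff T i" for i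
    using coeff_pcompose_linear[of T "- 1" i] by simp
  then have "coeff T i = 0" if "odd i" for i
    using that assms by (metis add_eq_0_iff2 minus_one_power_iff mult_2 mult_eq_0_iff mult_minus1)
  then obtain S where S: "T = pcompose S [:0, 0, 1:]" using even_polynomial by blast
  have "P = pcompose T [:- \<alpha>, 1:]" by (simp add: T_def pcompose_assoc[symmetric] pcompose_pCons)
  also have "\<dots> = pcompose S ([:- \<alpha>, 1:] ^ 2)"
    by (simp add: S pcompose_assoc[symmetric] pcompose_pCons power2_eq_square)
  finally show "polynomial_of ([:- \<alpha>, 1:] ^ 2) P" by (auto simp: polynomial_of_def)
qed

section \<open>Composites and reflections of the endomorphism\<close>

context endomorphism
begin

text \<open>
  \<open>b\<close> stands for \<open>\<alpha> * (p - q)\<close>; then \<open>p\<close> and \<open>q\<close> are recovered as \<open>(u + b) / (2 * \<alpha>)\<close> and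
  \<open>(u - b) / (2 * \<alpha>)\<close>, and the two identities for \<open>b\<close> say that these are idempotent.
\<close>

lemma composite_iff:
  assumes "\<alpha> \<noteq> 0" "(2 :: 'a) \<noteq> 0"
  shows "composite scale \<alpha> \<alpha> u \<longleftrightarrow> (\<exists>b. Vector_Spaces.linear scale scale b \<and>
    (\<forall>x. b (u x) = (2 * \<alpha>) *s b x - u (b x)) \<and> (\<forall>x. b (b x) = (2 * \<alpha>) *s u x - u (u x)))"
proof
  assume "composite scale \<alpha> \<alpha> u"
  then obtain p q where p: "Vector_Spaces.linear scale scale p" "p \<circ> p = p"
    and q: "Vector_Spaces.linear scale scale q" "q \<circ> q = q"
    and u: "u = (\<lambda>v. \<alpha> *s p v + \<alpha> *s q v)"
    unfolding composite_def by blast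
  interpret p: Vector_Spaces.linear scale scale p by fact
  interpret q: Vector_Spaces.linear scale scale q by fact
  have pp: "p (p x) = p x" and qq: "q (q x) = q x" for x using p(2) q(2) by (metis comp_apply)+
  define b where "b x = \<alpha> *s (p x - q x)" for x
  have "Vector_Spaces.linear scale scale b"
    by (simp add: Vector_Spaces.linear_iff vector_space_axioms b_def p.add q.add p.scale q.scale
        scale_right_distrib scale_right_diff_distrib mult.commute)
  moreover have "b (u x) = (2 * \<alpha>) *s b x - u (b x)" "b (b x) = (2 * \<alpha>) *s u x - u (u x)" for x
  proof -
    have double: "(\<alpha> * \<alpha>) *s (y + w) + (\<alpha> * \<alpha>) *s (y - w) = (2 * \<alpha>) *s \<alpha> *s y" for y w
    proof -
      have "(\<alpha> * \<alpha>) *s (y + w) + (\<alpha> * \<alpha>) *s (y - w) = (\<alpha> * \<alpha>) *s (y + y)"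
        by (simp only: scale_right_distrib[symmetric]) simp
      also have "\<dots> = (2 * \<alpha>) *s \<alpha> *s y"
        by (simp only: scale_right_distrib scale_left_distrib mult_2 scale_scale distrib_right)
      finally show ?thesis .
    qed
    have u_eq: "u y = \<alpha> *s (p y + q y)" for y by (simp add: u scale_right_distrib)
    have "b (u x) = (\<alpha> * \<alpha>) *s ((p x - q x) + (p (q x) - q (p x)))"
      "u (b x) = (\<alpha> * \<alpha>) *s ((p x - q x) - (p (q x) - q (p x)))"
      "b (b x) = (\<alpha> * \<alpha>) *s ((p x + q x) - (p (q x) + q (p x)))"
      "u (u x) = (\<alpha> * \<alpha>) *s ((p x + q x) + (p (q x) + q (p x)))"
      unfolding u_eq b_def p.add q.add p.diff q.diff p.scale q.scale pp qq
        scale_right_diff_distrib[symmetric] scale_right_distrib[symmetric] scale_scale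
      by (simp_all add: algebra_simps)
    then have "b (u x) + u (b x) = (2 * \<alpha>) *s b x" "u (u x) + b (b x) = (2 * \<alpha>) *s u x"
      using double by (simp_all only: b_def[of x] u_eq[of x])
    then show "b (u x) = (2 * \<alpha>) *s b x - u (b x)" "b (b x) = (2 * \<alpha>) *s u x - u (u x)"
      by (simp_all only: eq_diff_eq add.commute)
  qed
  ultimately show "\<exists>b. Vector_Spaces.linear scale scale b \<and>
    (\<forall>x. b (u x) = (2 * \<alpha>) *s b x - u (b x)) \<and> (\<forall>x. b (b x) = (2 * \<alpha>) *s u x - u (u x))" by blast
next
  assume "\<exists>b. Vector_Spaces.linear scale scale b \<and>
    (\<forall>x. b (u x) = (2 * \<alpha>) *s b x - u (b x)) \<and> (\<forall>x. b (b x) = (2 * \<alpha>) *s u x - u (u x))"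
  then obtain b where b: "Vector_Spaces.linear scale scale b"
    and bu: "\<And>x. b (u x) = (2 * \<alpha>) *s b x - u (b x)" and bb: "\<And>x. b (b x) = (2 * \<alpha>) *s u x - u (u x)"
    by blast
  interpret b: Vector_Spaces.linear scale scale b by fact
  define c where "c = inverse (2 * \<alpha>)"
  have c: "c * (2 * \<alpha>) = 1" using assms by (simp add: c_def)
  define p where "p x = c *s (u x + b x)" for x
  define q where "q x = c *s (u x - b x)" for x
  have "Vector_Spaces.linear scale scale p" "Vector_Spaces.linear scale scale q"
    by (simp_all add: Vector_Spaces.linear_iff vector_space_axioms p_def q_def b.add b.scale u.add u.scale
        scale_right_distrib scale_right_diff_distrib mult.commute)
  moreover have "p (p x) = p x" for x
  proof -
    have "p (p x) = c *s c *s (u (u x) + u (b x) + (b (u x) + b (b x)))"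
      by (simp add: p_def b.add b.scale u.add u.scale scale_right_distrib)
    also have "u (u x) + u (b x) + (b (u x) + b (b x)) = (2 * \<alpha>) *s (u x + b x)"
      by (simp add: bu bb scale_right_distrib)
    also have "c *s c *s (2 * \<alpha>) *s (u x + b x) = (c * (c * (2 * \<alpha>))) *s (u x + b x)" by simp
    finally show ?thesis unfolding c by (simp add: p_def)
  qed
  moreover have "q (q x) = q x" for x
  proof -
    have "q (q x) = c *s c *s (u (u x) - u (b x) - (b (u x) - b (b x)))"
      by (simp add: q_def b.diff b.scale u.diff u.scale scale_right_diff_distrib)
    also have "u (u x) - u (b x) - (b (u x) - b (b x)) = (2 * \<alpha>) *s (u x - b x)"
      by (simp add: bu bb scale_right_diff_distrib)
    also have "c *s c *s (2 * \<alpha>) *s (u x - b x) = (c * (c * (2 * \<alpha>))) *s (u x - b x)" by simp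
    finally show ?thesis unfolding c by (simp add: q_def)
  qed
  moreover have "u x = \<alpha> *s p x + \<alpha> *s q x" for x
  proof -
    have "\<alpha> *s p x + \<alpha> *s q x = (\<alpha> * c) *s (u x + u x)"
      by (simp add: p_def q_def scale_right_distrib scale_right_diff_distrib)
    also have "\<dots> = (c * (2 * \<alpha>)) *s u x"
      by (simp add: scale_right_distrib scale_left_distrib[symmetric] mult_2 algebra_simps)
    finally show ?thesis using c by simp
  qed
  ultimately show "composite scale \<alpha> \<alpha> u"
    unfolding composite_def by (intro exI[of _ p] exI[of _ q]) auto
qed

lemma n_seq_eq:
  "n_seq scale u c k = int (dim {x. ([:- c, 1:] ^ k) \<star> x = 0}) - int (dim {x. ([:- c, 1:] ^ (k - 1)) \<star> x = 0})"
proof -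
  have "(\<lambda>v. u v - c *s v) = act [:- c, 1:]" by (simp add: act_linear_poly fun_eq_iff)
  then show ?thesis by (simp add: n_seq_def act_power)
qed

end

section \<open>Necessity of the conditions\<close>

text \<open>
  The situation of lemma \<open>composite_iff\<close>: for a composite \<open>u\<close>, \<open>b\<close> is \<open>\<alpha>\<close> times the difference of the
  two idempotents.
\<close>

locale reflected_endomorphism = endomorphism +
  fixes \<alpha> :: 'a and b :: "'b \<Rightarrow> 'b"
  assumes linear_b: "Vector_Spaces.linear scale scale b"
    and b_u: "b (u x) = (2 * \<alpha>) *s b x - u (b x)"
    and b_b: "b (b x) = (2 * \<alpha>) *s u x - u (u x)"
    and nonzero: "2 * \<alpha> \<noteq> 0"

begin

sublocale b: Vector_Spaces.linear scale scale b
  by (rule linear_b)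

lemma b_act: "b (P \<star> x) = reflect \<alpha> P \<star> b x"
proof (induction P)
  case 0
  then show ?case by (simp add: reflect_def b.zero)
next
  case (pCons c P)
  have "reflect \<alpha> (pCons c P) = [:c:] + [:2 * \<alpha>, - 1:] * reflect \<alpha> P"
    by (simp add: reflect_def pcompose_pCons)
  then have "reflect \<alpha> (pCons c P) \<star> b x = c *s b x + ((2 * \<alpha>) *s (reflect \<alpha> P \<star> b x) - u (reflect \<alpha> P \<star> b x))"
    by (simp only: act_add_left act_mult) (simp add: act_pCons u.neg)
  then show ?case using pCons.IH by (simp add: act_pCons b.add b.scale b_u)
qed

lemma b_b_act: "b (b x) = ([:0, 1:] * [:2 * \<alpha>, - 1:]) \<star> x"
  unfolding act_mult by (simp add: act_pCons b_b u.diff u.scale u.neg)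

lemma b_even_power: "(b ^^ (2 * k)) x = (([:0, 1:] * [:2 * \<alpha>, - 1:]) ^ k) \<star> x"
  by (induction k) (simp_all add: b_b_act act_mult del: mult_pCons_left mult_pCons_right)

text \<open>
  Inside the generalized eigenspaces, \<open>(u - c) ^^ k\<close> has the same kernel as \<open>b ^^ (2 * k)\<close>. The odd
  powers of \<open>b\<close> lie in between, and one application of \<open>b\<close> moves to the other eigenspace and lowers the
  power by one; this is why exactly one index is lost.
\<close>

lemma n_seq_le:
  assumes c: "c = 0 \<and> c' = 2 * \<alpha> \<or> c = 2 * \<alpha> \<and> c' = 0" and k: "k \<ge> 1"
  shows "n_seq scale u c (k + 1) \<le> n_seq scale u c' k"
proof -
  define X where "X a = [:- a, 1 :: 'a:]" for a
  define N where "N = [:0, 1:] * [:2 * \<alpha>, - 1:]"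
  \<comment> \<open>The exponent \<open>k + 1\<close> is large enough for the kernels that occur below, so \<open>A a j\<close> is the
    kernel of \<open>b ^^ j\<close> in the generalized eigenspace at \<open>a\<close>.\<close>
  define A where "A a j = {x \<in> {x. (b ^^ j) x = 0}. (X a ^ (k + 1)) \<star> x = 0}" for a j
  define dimA where "dimA a j = int (dim (A a j))" for a j
  have linear_b_power: "Vector_Spaces.linear scale scale (b ^^ j)" for j
    by (induction j) (simp_all add: Vector_Spaces.linear_iff vector_space_axioms b.add b.scale)
  have sub: "subspace (A a j)" for a j
    using linear_b_power[of j] unfolding subspace_def A_def Vector_Spaces.linear_iff
    by (auto simp: act_add act_scale act.zero) (metis scale_zero_left)
  have swap: "(b ^^ j) (b x) = (b ^^ Suc j) x" for j x by (simp add: funpow_swap1)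
  \<comment> \<open>\<open>b\<close> embeds \<open>A a (j + 2) / A a (j + 1)\<close> into \<open>A a' (j + 1) / A a' j\<close>.\<close>
  have step: "dimA a (j + 2) - dimA a (j + 1) \<le> dimA a' (j + 1) - dimA a' j"
    if a: "a = 0 \<and> a' = 2 * \<alpha> \<or> a = 2 * \<alpha> \<and> a' = 0" for a a' j
    unfolding dimA_def
  proof (rule dim_diff_le_of_linear[OF linear_b])
    have mono: "A a i \<subseteq> A a (Suc i)" for a i by (auto simp: A_def b.zero)
    then show "A a (j + 1) \<subseteq> A a (j + 2)" "A a' j \<subseteq> A a' (j + 1)" by simp_all
    show "b x \<in> A a' (j + 1)" if "x \<in> A a (j + 2)" for x
    proof -
      have "(reflect \<alpha> (X a ^ (k + 1))) \<star> b x = 0"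
        using that b_act[of "X a ^ (k + 1)" x] by (simp add: A_def b.zero)
      moreover have "reflect \<alpha> (X a ^ (k + 1)) = (- X a') ^ (k + 1)"
        using a unfolding reflect_power X_def reflect_linear by auto
      ultimately have "(X a' ^ (k + 1)) \<star> b x = 0"
        using act_eq_0_dvd power_dvd_minus_power[of "k + 1" "k + 1" "- X a'"] by (metis le_refl minus_minus)
      moreover have "(b ^^ (j + 1)) (b x) = 0" using that unfolding swap by (simp add: A_def)
      ultimately show ?thesis by (simp add: A_def)
    qed
    show "x \<in> A a (j + 1)" if "x \<in> A a (j + 2)" "b x \<in> A a' j" for x
      using that swap[of j x] by (simp add: A_def)
  qed (rule sub)+
  \<comment> \<open>On the generalized eigenspace at \<open>a\<close>, the square of \<open>b\<close> is \<open>u - a\<close> times the invertible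
    \<open>- (u - a')\<close>.\<close>
  have kernel: "{x. (X a ^ i) \<star> x = 0} = A a (2 * i)" if "i \<le> k + 1" and a: "a = 0 \<and> a' = 2 * \<alpha> \<or> a = 2 * \<alpha> \<and> a' = 0" for a a' i
  proof (intro equalityI subsetI)
    have N: "N = - (X a * X a')" using a by (auto simp: N_def X_def)
    {
      fix x assume "x \<in> {x. (X a ^ i) \<star> x = 0}"
      then have x: "(X a ^ i) \<star> x = 0" by simp
      have "X a ^ i dvd N ^ i" unfolding N by (intro dvd_power_same) simp
      then have "(b ^^ (2 * i)) x = 0" unfolding b_even_power N_def[symmetric] using act_eq_0_dvd[OF x] by blast
      moreover have "(X a ^ (k + 1)) \<star> x = 0" using act_eq_0_dvd[OF x] that(1) le_imp_power_dvd by blast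
      ultimately show "x \<in> A a (2 * i)" by (simp add: A_def)
    next
      fix x assume x: "x \<in> A a (2 * i)"
      then have "(N ^ i) \<star> x = 0" using b_even_power[of i x] by (simp add: A_def N_def)
      moreover have "N ^ i dvd X a' ^ i * X a ^ i"
        unfolding N power_mult_distrib[symmetric] using power_dvd_minus_power[of i i "- (X a * X a')"]
        by (simp add: mult.commute)
      ultimately have "(X a' ^ i) \<star> (X a ^ i) \<star> x = 0" using act_eq_0_dvd act_mult by metis
      moreover have "(X a ^ (k + 1)) \<star> (X a ^ i) \<star> x = 0"
        using x act_commute[of "X a ^ (k + 1)" "X a ^ i" x] by (simp add: A_def act.zero)
      moreover have "coprime (X a' ^ i) (X a ^ (k + 1))"
      proof -
        have "coprime (X a) (X a')" using a nonzero unfolding X_def coprime_linear_iff by auto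
        then show ?thesis using coprime_poly_power_right coprime_commute by blast
      qed
      ultimately have "(X a ^ i) \<star> x = 0" using coprime_act_eq_0 by blast
      then show "x \<in> {x. (X a ^ i) \<star> x = 0}" by simp
    }
  qed
  define i where "i = 2 * (k - 1)"
  have i: "2 * k = i + 2" "2 * (k + 1) = i + 4" using k by (simp_all add: i_def)
  have c': "c' = 0 \<and> c = 2 * \<alpha> \<or> c' = 2 * \<alpha> \<and> c = 0" using c by blast
  have dimA: "int (dim {x. ([:- a, 1:] ^ j) \<star> x = 0}) = dimA a (2 * j)"
    if "j \<le> k + 1" "a = 0 \<and> a' = 2 * \<alpha> \<or> a = 2 * \<alpha> \<and> a' = 0" for a a' j
    using kernel[OF that] by (simp only: dimA_def X_def)
  have "n_seq scale u c (k + 1) = dimA c (2 * (k + 1)) - dimA c (2 * k)"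
    using dimA[OF _ c, of "k + 1"] dimA[OF _ c, of k] by (simp only: n_seq_eq) simp
  moreover have "n_seq scale u c' k = dimA c' (2 * k) - dimA c' i"
    using dimA[OF _ c', of k] dimA[OF _ c', of "k - 1"] by (simp only: n_seq_eq i_def)
  ultimately show ?thesis
    \<comment> \<open>The first three steps bound the upper half of the left-hand side, the last one the lower
      half.\<close>
    using step[OF c, of "i + 2"] step[OF c', of "i + 1"] step[OF c, of i] step[OF c, of "i + 1"]
    unfolding i by (simp add: numeral_eq_Suc)
qed

text \<open>
  On the rootless space \<open>b\<close> is an isomorphism between \<open>u\<close> and \<open>2 * \<alpha> - u\<close>, so the elementary factors and
  their reflections satisfy the same dimension formulas.
\<close>

lemma elementary_factors_reflect:
  assumes P: "P \<in> set (elementary_factors scale (rootless_space scale u {0, \<alpha>, 2 * \<alpha>}) u)"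
  shows "reflect \<alpha> P = P"
proof -
  define \<Lambda> where "\<Lambda> = {0, \<alpha>, 2 * \<alpha>}"
  define Q where "Q = rootless_part \<Lambda> (min_poly scale u)"
  define W where "W = rootless_space scale u \<Lambda>"
  define Es where "Es = rev (elementary_factors scale W u)"
  note Es = elementary_factors_cyclic_decomp[OF stable_rootless_space[of \<Lambda>], folded W_def, folded Es_def]
  have W: "W = {x. Q \<star> x = 0}" by (simp add: W_def Q_def rootless_space_eq)
  have Q_root: "poly Q c \<noteq> 0" if "c \<in> \<Lambda>" for c using rootless_part_nonroot that by (simp add: Q_def)
  have \<Lambda>: "2 * \<alpha> - c \<in> \<Lambda>" if "c \<in> \<Lambda>" for c using that by (auto simp: \<Lambda>_def)
  have b_W: "b x \<in> W" if "x \<in> W" for x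
    unfolding W_def
  proof (rule in_rootless_space)
    have "b (Q \<star> x) = 0" using that by (simp add: W b.zero)
    then show "reflect \<alpha> Q \<star> b x = 0" by (simp add: b_act)
    show "poly (reflect \<alpha> Q) c \<noteq> 0" if "c \<in> \<Lambda>" for c using Q_root \<Lambda> that by (simp add: poly_reflect)
  qed
  have "subspace W" using stable_rootless_space[of \<Lambda>] by (simp add: stable_def W_def)
  have inj: "inj_on b W"
  proof (subst b.inj_on_iff_eq_0[OF \<open>subspace W\<close>])
    have "x = 0" if x: "x \<in> W" "b x = 0" for x
    proof (rule coprime_act_eq_0[of Q "[:- 0, 1:] * [:- (2 * \<alpha>), 1:]"])
      have "b (b x) = 0" using x by (simp add: b.zero)
      then have "([:0, 1:] * [:2 * \<alpha>, - 1:]) \<star> x = 0" by (simp only: b_b_act)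
      then show "([:- 0, 1:] * [:- (2 * \<alpha>), 1:]) \<star> x = 0"
        by (rule act_eq_0_dvd) (rule dvd_minus_iff[THEN iffD1], simp)
      show "Q \<star> x = 0" using x by (simp add: W)
      show "coprime Q ([:- 0, 1:] * [:- (2 * \<alpha>), 1:])"
        using Q_root by (intro coprime_poly_mult_right) (simp_all only: coprime_linear_iff, simp_all add: \<Lambda>_def)
    qed
    then show "\<forall>x\<in>W. b x = 0 \<longrightarrow> x = 0" by blast
  qed
  interpret pair: finite_dimensional_vector_space_pair scale Basis scale Basis by unfold_locales
  have le: "dim {y \<in> W. R \<star> y = 0} \<le> dim {y \<in> W. reflect \<alpha> R \<star> y = 0}" for R
  proof -
    have span: "span {y \<in> W. R \<star> y = 0} = {y \<in> W. R \<star> y = 0}"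
      using stable_kernel[OF stable_rootless_space[of \<Lambda>], of R] unfolding span_eq_iff stable_def W_def by simp
    have "inj_on b (span {y \<in> W. R \<star> y = 0})"
      unfolding span using inj by (rule inj_on_subset) blast
    then have "dim (b ` {y \<in> W. R \<star> y = 0}) = dim {y \<in> W. R \<star> y = 0}"
      by (rule pair.dim_image_eq[OF linear_b])
    moreover have "b ` {y \<in> W. R \<star> y = 0} \<subseteq> {y \<in> W. reflect \<alpha> R \<star> y = 0}"
      using b_W by (auto simp: b_act[symmetric] b.zero)
    ultimately show ?thesis
      using dim_subset[of "b ` {y \<in> W. R \<star> y = 0}" "{y \<in> W. reflect \<alpha> R \<star> y = 0}"] by linarith
  qed
  \<comment> \<open>Reflecting twice gives back \<open>R\<close>, so the two injections force equality.\<close>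
  have eq: "dim {y \<in> W. R \<star> y = 0} = dim {y \<in> W. reflect \<alpha> R \<star> y = 0}" for R
    using le[of R] le[of "reflect \<alpha> R"] by simp
  \<comment> \<open>The sign makes the reflected polynomial monic again.\<close>
  define mrefl where "mrefl P = Polynomial.smult ((- 1) ^ degree P) (reflect \<alpha> P)" for P
  have unit: "(- 1 :: 'a) ^ n * (- 1) ^ n = 1" for n by (simp flip: power_mult_distrib)
  have mrefl: "lead_coeff (mrefl P) = lead_coeff P" "degree (mrefl P) = degree P"
    "degree (pgcd (mrefl P) R) = degree (pgcd P (reflect \<alpha> R))" for P R
  proof -
    show "degree (mrefl P) = degree P" by (simp add: mrefl_def)
    then show "lead_coeff (mrefl P) = lead_coeff P"
      using lead_coeff_reflect[of \<alpha> P] unit[of "degree P"] by (simp add: mrefl_def flip: mult.assoc)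
    have "degree (pgcd (mrefl P) R) = degree (pgcd (reflect \<alpha> P) R)"
      by (rule degree_pgcd_cong) (simp add: mrefl_def dvd_smult_iff)
    then show "degree (pgcd (mrefl P) R) = degree (pgcd P (reflect \<alpha> R))" by (simp add: degree_pgcd_reflect)
  qed
  have "map mrefl Es = Es"
  proof (rule divisor_chain_unique)
    have "mrefl A dvd mrefl B" if "A dvd B" for A B
      using that by (simp add: mrefl_def dvd_smult_iff smult_dvd_iff reflect_dvd_reflect_iff)
    then show "sorted_wrt (\<lambda>P Q. Q dvd P) (map mrefl Es)"
      using Es(2) by (auto simp: sorted_wrt_map intro: sorted_wrt_mono_rel[rotated])
    show "\<forall>P\<in>set (map mrefl Es). lead_coeff P = 1 \<and> degree P > 0" using Es(3) mrefl by (simp add: Es_def)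
    show "\<forall>P\<in>set Es. lead_coeff P = 1 \<and> degree P > 0" using Es(3) by (simp add: Es_def)
    show "(\<Sum>P\<leftarrow>map mrefl Es. degree (pgcd P R)) = (\<Sum>P\<leftarrow>Es. degree (pgcd P R))" for R
      using eq[of R] cyclic_decomp_dim_kernel[OF Es(1)] by (simp add: mrefl comp_def)
  qed (rule Es(2))
  moreover have mem: "P \<in> set Es" using P by (simp add: Es_def W_def \<Lambda>_def)
  ultimately have fixed: "mrefl P = P" using map_eq_conv[of mrefl Es id] by simp
  have "P dvd Q" using cyclic_decomp_dvd[OF Es(1) mem] by (simp add: W)
  then have nz: "poly P \<alpha> \<noteq> 0" using Q_root[of \<alpha>] by (auto simp: \<Lambda>_def elim: dvdE)
  \<comment> \<open>The sign is \<open>1\<close>: \<open>\<alpha>\<close> is fixed by the reflection and is not a root of \<open>P\<close>.\<close>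
  have "(- 1) ^ degree P * poly P \<alpha> = poly (mrefl P) \<alpha>" by (simp add: mrefl_def poly_reflect)
  then have "(- 1 :: 'a) ^ degree P = 1" using nz by (simp add: fixed)
  then show ?thesis using fixed by (simp add: mrefl_def)
qed

end

section \<open>Sufficiency of the conditions\<close>

context endomorphism
begin

text \<open>
  The kernel of \<open>(u - c) ^^ k\<close> has dimension \<open>\<Sum>D. min k (order c D)\<close>, and raising \<open>k - 1\<close> to \<open>k\<close> adds one
  for every invariant factor of order at least \<open>k\<close>; these are the Jordan blocks of size at least \<open>k\<close>.
\<close>

lemma n_seq_cyclic_decomp:
  assumes "cyclic_decomp UNIV Ds" "k \<ge> 1"
  shows "n_seq scale u c k = int (length (filter (\<lambda>D. k \<le> order c D) Ds))"
proof -
  have nz: "D \<noteq> 0" if "D \<in> set Ds" for D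
  proof -
    have "D dvd min_poly scale u" using cyclic_decomp_dvd[OF assms(1) that] min_poly(2)[of "min_poly scale u"] by simp
    moreover have "min_poly scale u \<noteq> 0" using min_poly(1) by auto
    ultimately show ?thesis by auto
  qed
  have dim: "dim {x. ([:- c, 1:] ^ k) \<star> x = 0} = (\<Sum>D\<leftarrow>Ds. min k (order c D))" for k
  proof -
    have "dim {x. ([:- c, 1:] ^ k) \<star> x = 0} = (\<Sum>D\<leftarrow>Ds. degree (pgcd D ([:- c, 1:] ^ k)))"
      using cyclic_decomp_dim_kernel[OF assms(1), of "[:- c, 1:] ^ k"] by simp
    also have "map (\<lambda>D. degree (pgcd D ([:- c, 1:] ^ k))) Ds = map (\<lambda>D. min k (order c D)) Ds"
      using nz degree_pgcd_linear_power by (intro map_cong) auto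
    finally show ?thesis .
  qed
  have "(\<Sum>D\<leftarrow>Ds. min k (order c D)) = (\<Sum>D\<leftarrow>Ds. min (k - 1) (order c D)) + length (filter (\<lambda>D. k \<le> order c D) Ds)"
    using assms(2) by (induction Ds) auto
  then show ?thesis by (simp add: n_seq_eq dim)
qed

text \<open>
  Half of the intertwining condition bounds the order at one eigenvalue by the order at the other, in
  every single invariant factor: both orders are monotone along the chain, so comparing how many are
  large compares the orders at each position.
\<close>

lemma order_le_of_n_seq:
  assumes Ds: "cyclic_decomp UNIV Ds" "sorted_wrt (\<lambda>P Q. Q dvd P) Ds" "\<forall>D\<in>set Ds. lead_coeff D = 1 \<and> degree D > 0"
    and le: "\<And>k. k \<ge> 1 \<Longrightarrow> n_seq scale u c (k + 1) \<le> n_seq scale u c' k"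
    and D: "D \<in> set Ds"
  shows "order c D \<le> order c' D + 1"
proof (rule ccontr)
  assume "\<not> order c D \<le> order c' D + 1"
  \<comment> \<open>As the orders decrease along the chain, at least \<open>i + 1\<close> factors have order at least \<open>k + 1\<close>
    at \<open>c\<close>, but at most \<open>i\<close> have order at least \<open>k\<close> at \<open>c'\<close>.\<close>
  define k where "k = order c D - 1"
  have k: "k \<ge> 1" "order c D = k + 1" "order c' D < k"
    using \<open>\<not> order c D \<le> order c' D + 1\<close> by (auto simp: k_def)
  obtain i where i: "i < length Ds" "D = Ds ! i" using D by (auto simp: in_set_conv_nth)
  have mono: "order a (Ds ! m) \<le> order a (Ds ! l)" if "l \<le> m" "m < length Ds" for a l m
  proof (cases "l = m")
    case False
    then have "Ds ! m dvd Ds ! l" using sorted_wrt_nth_less[OF Ds(2)] that by simp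
    moreover have "Ds ! l \<noteq> 0" using Ds(3) that by (metis degree_0 le_less_trans less_irrefl nth_mem)
    ultimately show ?thesis by (rule dvd_imp_order_le[rotated])
  qed simp
  have "{..i} \<subseteq> {j. j < length Ds \<and> k + 1 \<le> order c (Ds ! j)}"
    using mono[of _ i c] i k(2) by force
  then have "card {..i} \<le> card {j. j < length Ds \<and> k + 1 \<le> order c (Ds ! j)}"
    by (intro card_mono) auto
  then have "int (Suc i) \<le> n_seq scale u c (k + 1)"
    by (simp add: n_seq_cyclic_decomp[OF Ds(1)] length_filter_conv_card)
  moreover have "{j. j < length Ds \<and> k \<le> order c' (Ds ! j)} \<subseteq> {..<i}"
  proof
    fix j assume j: "j \<in> {j. j < length Ds \<and> k \<le> order c' (Ds ! j)}"
    show "j \<in> {..<i}"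
    proof (rule ccontr)
      assume "j \<notin> {..<i}"
      then have "order c' (Ds ! j) \<le> order c' (Ds ! i)" using mono j by simp
      then show False using j k(3) i by simp
    qed
  qed
  then have "card {j. j < length Ds \<and> k \<le> order c' (Ds ! j)} \<le> card {..<i}"
    by (intro card_mono) auto
  then have "n_seq scale u c' k \<le> int i"
    using k(1) by (simp add: n_seq_cyclic_decomp[OF Ds(1)] length_filter_conv_card)
  ultimately show False using le[OF k(1)] by simp
qed

text \<open>
  On a cyclic summand generated by \<open>x\<close>, map \<open>f \<star> x\<close> to \<open>g * reflect \<alpha> f \<star> x\<close>. This anticommutes with
  \<open>X - \<alpha>\<close>, its square is multiplication by \<open>g * reflect \<alpha> g\<close>, and it is well defined because
  \<open>P dvd g * reflect \<alpha> P\<close>.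
\<close>

lemma cyclic_decomp_reflection:
  assumes "cyclic_decomp W Ps"
    and "\<forall>P\<in>set Ps. \<exists>g. g * reflect \<alpha> g = [:0, 1:] * [:2 * \<alpha>, - 1:] \<and> P dvd g * reflect \<alpha> P"
  shows "\<exists>b. (\<forall>x\<in>W. b x \<in> W) \<and> (\<forall>x\<in>W. \<forall>y\<in>W. b (x + y) = b x + b y) \<and>
    (\<forall>c. \<forall>x\<in>W. b (c *s x) = c *s b x) \<and> (\<forall>x\<in>W. b (u x) = [:2 * \<alpha>, - 1:] \<star> b x) \<and>
    (\<forall>x\<in>W. b (b x) = ([:0, 1:] * [:2 * \<alpha>, - 1:]) \<star> x)"
proof -
  define N where "N = [:0, 1:] * [:2 * \<alpha>, - 1:]"
  show ?thesis
    using assms unfolding N_def[symmetric]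
  proof (induction Ps arbitrary: W)
    case Nil
    then show ?case by (intro exI[of _ "\<lambda>x. x"]) (simp add: act.zero u.zero)
  next
    case (Cons P Ps)
    obtain x W' where x: "annihilator x P" "stable W'" "direct_sum W (cyclic x) W'" "cyclic_decomp W' Ps"
      using Cons.prems(1) by auto
    have "\<forall>P\<in>set Ps. \<exists>g. g * reflect \<alpha> g = N \<and> P dvd g * reflect \<alpha> P" using Cons.prems(2) by simp
    from Cons.IH[OF x(4) this] obtain b' where *: "(\<forall>w\<in>W'. b' w \<in> W') \<and>
      (\<forall>w\<in>W'. \<forall>z\<in>W'. b' (w + z) = b' w + b' z) \<and> (\<forall>c. \<forall>w\<in>W'. b' (c *s w) = c *s b' w) \<and>
      (\<forall>w\<in>W'. b' (u w) = [:2 * \<alpha>, - 1:] \<star> b' w) \<and> (\<forall>w\<in>W'. b' (b' w) = N \<star> w)" by blast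
    then have b': "\<And>w. w \<in> W' \<Longrightarrow> b' w \<in> W'"
      "\<And>w z. w \<in> W' \<Longrightarrow> z \<in> W' \<Longrightarrow> b' (w + z) = b' w + b' z"
      "\<And>c w. w \<in> W' \<Longrightarrow> b' (c *s w) = c *s b' w" "\<And>w. w \<in> W' \<Longrightarrow> b' (u w) = [:2 * \<alpha>, - 1:] \<star> b' w"
      "\<And>w. w \<in> W' \<Longrightarrow> b' (b' w) = N \<star> w"
      by simp_all
    obtain g where g: "g * reflect \<alpha> g = N" "P dvd g * reflect \<alpha> P" using Cons.prems(2) by auto
    have sW': "subspace W'" using x(2) by (simp add: stable_def)
    have sZ: "subspace (cyclic x)" using stable_cyclic[of x] by (simp add: stable_def)
    \<comment> \<open>The representation of \<open>y\<close> by \<open>f\<close> and \<open>w\<close> is unique only modulo \<open>P\<close>; the next fact shows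
      that the choice is irrelevant.\<close>
    define b where "b y = (let (f, w) = SOME (f, w). w \<in> W' \<and> y = f \<star> x + w in (g * reflect \<alpha> f) \<star> x + b' w)" for y
    have b: "b (f \<star> x + w) = (g * reflect \<alpha> f) \<star> x + b' w" if w: "w \<in> W'" for f w
    proof -
      obtain f' w' where fw': "(SOME (f', w'). w' \<in> W' \<and> f \<star> x + w = f' \<star> x + w') = (f', w')" by force
      have "case (f', w') of (f', w') \<Rightarrow> w' \<in> W' \<and> f \<star> x + w = f' \<star> x + w'"
        unfolding fw'[symmetric] by (rule someI[of _ "(f, w)"]) (simp add: w)
      then have *: "w' \<in> W'" "f \<star> x + w = f' \<star> x + w'" by auto
      then have eq: "f \<star> x = f' \<star> x" "w = w'"
        using direct_sum_unique[OF sZ sW' x(3), of "f \<star> x" "f' \<star> x" w w'] w by auto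
      then have "(f - f') \<star> x = 0" by (simp add: act_diff_left)
      then have "P dvd f - f'" using annihilator_dvd_iff[OF x(1)] by blast
      \<comment> \<open>This is where \<open>P dvd g * reflect \<alpha> P\<close> enters.\<close>
      then have "g * reflect \<alpha> P dvd g * reflect \<alpha> (f - f')" by (simp add: reflect_dvd_reflect_iff mult_dvd_mono)
      then have "P dvd g * reflect \<alpha> (f - f')" using g(2) dvd_trans by blast
      then have "(g * reflect \<alpha> (f - f')) \<star> x = 0" using annihilator_dvd_iff[OF x(1)] by blast
      then have "(g * reflect \<alpha> f) \<star> x = (g * reflect \<alpha> f') \<star> x"
        by (simp add: reflect_diff right_diff_distrib act_diff_left)
      then show ?thesis unfolding b_def fw' using eq(2) by simp
    qed
    have W: "\<exists>f w. y = f \<star> x + w \<and> w \<in> W'" if "y \<in> W" for y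
      using that x(3) unfolding direct_sum_def by blast
    have mem: "f \<star> x + w \<in> W" if "w \<in> W'" for f w
      using that x(3) unfolding direct_sum_def by blast
    show ?case
    proof (intro exI[of _ b] conjI ballI allI)
      fix y assume "y \<in> W"
      then obtain f w where y: "y = f \<star> x + w" "w \<in> W'" using W by blast
      show "b y \<in> W" unfolding y(1) b[OF y(2)] using b'(1) y(2) by (intro mem)
      show "b (u y) = [:2 * \<alpha>, - 1:] \<star> b y"
      proof -
        have uw: "u w \<in> W'" using x(2) y(2) by (simp add: stable_def)
        have "u y = ([:0, 1:] * f) \<star> x + u w" by (simp add: y(1) u.add act_pCons)
        then have "b (u y) = (g * reflect \<alpha> ([:0, 1:] * f)) \<star> x + b' (u w)" using b[OF uw] by simp
        also have "g * reflect \<alpha> ([:0, 1:] * f) = [:2 * \<alpha>, - 1:] * (g * reflect \<alpha> f)"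
        proof -
          have "reflect \<alpha> [:0, 1:] = [:2 * \<alpha>, - 1:]" by (simp add: reflect_def pcompose_pCons)
          then show ?thesis by (simp only: reflect_mult mult.left_commute)
        qed
        finally show ?thesis by (simp only: y(1) b[OF y(2)] b'(4)[OF y(2)] act_add act_mult)
      qed
      show "b (b y) = N \<star> y"
      proof -
        have "b (b y) = (g * reflect \<alpha> (g * reflect \<alpha> f)) \<star> x + b' (b' w)"
          using b b'(1) y by simp
        also have "g * reflect \<alpha> (g * reflect \<alpha> f) = N * f"
          by (simp add: reflect_mult g(1)[symmetric] mult.assoc)
        finally show ?thesis by (simp only: y(1) b'(5)[OF y(2)] act_add act_mult)
      qed
      show "b (c *s y) = c *s b y" for c
      proof -
        have cw: "c *s w \<in> W'" using sW' y(2) by (simp add: subspace_scale)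
        have "c *s y = Polynomial.smult c f \<star> x + c *s w" by (simp add: y(1) act_smult scale_right_distrib)
        then have "b (c *s y) = (g * reflect \<alpha> (Polynomial.smult c f)) \<star> x + b' (c *s w)"
          by (simp only: b[OF cw])
        also have "\<dots> = c *s ((g * reflect \<alpha> f) \<star> x) + c *s b' w"
          by (simp only: b'(3)[OF y(2)] reflect_smult act_smult mult_smult_right)
        finally show ?thesis by (simp only: y(1) b[OF y(2)] scale_right_distrib)
      qed
      fix z assume "z \<in> W"
      then obtain h v where z: "z = h \<star> x + v" "v \<in> W'" using W by blast
      have "w + v \<in> W'" using sW' y(2) z(2) by (simp add: subspace_add)
      moreover have "y + z = (f + h) \<star> x + (w + v)" by (simp add: y(1) z(1) act_add_left)
      ultimately have "b (y + z) = (g * reflect \<alpha> (f + h)) \<star> x + b' (w + v)" by (simp only: b)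
      also have "\<dots> = b y + b z"
        unfolding y(1) z(1) b[OF y(2)] b[OF z(2)] b'(2)[OF y(2) z(2)] reflect_add distrib_left act_add_left
        by (simp only: add_ac)
      finally show "b (y + z) = b y + b z" .
    qed
  qed
qed

text \<open>
  The reflection exchanges the orders of \<open>D\<close> at \<open>0\<close> and \<open>2 * \<alpha>\<close> and keeps the order at \<open>\<alpha>\<close> and the largest
  divisor \<open>B\<close> without these three roots. A linear factor \<open>g\<close> compensates for orders that differ by one.
\<close>

lemma exists_twist:
  fixes D :: "'a poly"
  assumes "\<alpha> \<noteq> 0" "(2 :: 'a) \<noteq> 0" "D \<noteq> 0"
    and orders: "order 0 D \<le> order (2 * \<alpha>) D + 1" "order (2 * \<alpha>) D \<le> order 0 D + 1"
    and B: "B dvd D" "reflect \<alpha> B = B" "\<And>c. c \<in> {0, \<alpha>, 2 * \<alpha>} \<Longrightarrow> poly B c \<noteq> 0"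
    and B_max: "\<And>R. R dvd D \<Longrightarrow> (\<And>c. c \<in> {0, \<alpha>, 2 * \<alpha>} \<Longrightarrow> poly R c \<noteq> 0) \<Longrightarrow> R dvd B"
  shows "\<exists>g. g * reflect \<alpha> g = [:0, 1:] * [:2 * \<alpha>, - 1:] \<and> D dvd g * reflect \<alpha> D"
proof -
  define X where "X c = [:- c, 1 :: 'a:]" for c
  have ref: "reflect \<alpha> (X 0) = - X (2 * \<alpha>)" "reflect \<alpha> (X \<alpha>) = - X \<alpha>" "reflect \<alpha> (X (2 * \<alpha>)) = - X 0"
    unfolding X_def reflect_linear by simp_all
  define k l m where "k = order 0 D" and "l = order (2 * \<alpha>) D" and "m = order \<alpha> D"
  have distinct: "2 * \<alpha> \<noteq> 0" "\<alpha> \<noteq> 2 * \<alpha>"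
    using assms(1,2) by (simp, metis add_cancel_right_right mult_2)
  have cop: "coprime (X a ^ i) (X c ^ j)" if "a \<noteq> c" for a c i j
  proof -
    have "coprime (X a) (X c)" using that unfolding X_def coprime_linear_iff by simp
    then have "coprime (X a) (X c ^ j)" by (rule coprime_poly_power_right)
    then show ?thesis using coprime_poly_power_right coprime_commute by blast
  qed
  \<comment> \<open>\<open>D = L * R\<close> where \<open>L\<close> collects the roots \<open>0\<close>, \<open>\<alpha>\<close>, \<open>2 * \<alpha>\<close> and \<open>R\<close>, which is \<open>B\<close> up to a
    unit, has none of them.\<close>
  define L where "L = X 0 ^ k * (X (2 * \<alpha>) ^ l * X \<alpha> ^ m)"
  have "L dvd D"
    unfolding L_def
  proof (intro coprime_poly_mult_dvd coprime_poly_mult_right cop)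
    show "X 0 ^ k dvd D" "X (2 * \<alpha>) ^ l dvd D" "X \<alpha> ^ m dvd D"
      unfolding X_def k_def l_def m_def by (rule order_1)+
  qed (use assms distinct in auto)
  then obtain R where R: "D = L * R" by (elim dvdE)
  have R_root: "poly R c \<noteq> 0" if c: "c \<in> {0, \<alpha>, 2 * \<alpha>}" for c
  proof
    assume "poly R c = 0"
    then have "X c dvd R" by (simp add: X_def poly_eq_0_iff_dvd)
    moreover have "X c ^ order c D dvd L" using c by (auto simp: L_def k_def l_def m_def)
    ultimately have "X c ^ order c D * X c dvd L * R" by (intro mult_dvd_mono)
    then show False using order_2[OF assms(3), of c] by (simp add: R[symmetric] X_def[symmetric] mult.commute)
  qed
  have "coprime B L"
    unfolding L_def using B(3)
    by (intro coprime_poly_mult_right coprime_poly_power_right) (simp_all only: X_def coprime_linear_iff, simp_all)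
  then have "B dvd R" using B(1) unfolding R by (rule coprime_poly_dvd_cancel)
  moreover have "R dvd B" using B_max R_root R by simp
  ultimately have dvd_R: "R dvd reflect \<alpha> R"
    using B(2) reflect_dvd_reflect_iff[of \<alpha> B R] dvd_trans by metis
  have ref_D: "reflect \<alpha> D = (- X (2 * \<alpha>)) ^ k * ((- X 0) ^ l * (- X \<alpha>) ^ m) * reflect \<alpha> R"
    by (simp add: R L_def reflect_mult reflect_power ref)
  have N: "X 0 * (- X (2 * \<alpha>)) = [:0, 1:] * [:2 * \<alpha>, - 1:]" by (simp add: X_def)
  show ?thesis
  \<comment> \<open>The reflection swaps the exponents \<open>k\<close> of \<open>X\<close> and \<open>l\<close> of \<open>X - 2 * \<alpha>\<close>; the extra factor \<open>g\<close>
    makes up for a difference of one.\<close>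
  proof (cases "l \<le> k")
    case True
    have "X 0 ^ k dvd X 0 * (- X 0) ^ l"
    proof -
      have "X 0 ^ k dvd (- X 0) ^ Suc l" using orders(1) by (intro power_dvd_minus_power) (simp add: k_def l_def)
      then show ?thesis by simp
    qed
    then have "X 0 ^ k * (X (2 * \<alpha>) ^ l * X \<alpha> ^ m) * R dvd
        (X 0 * (- X 0) ^ l) * ((- X (2 * \<alpha>)) ^ k * (- X \<alpha>) ^ m) * reflect \<alpha> R"
      using True dvd_R by (intro mult_dvd_mono power_dvd_minus_power) auto
    also have "\<dots> = X 0 * reflect \<alpha> D" unfolding ref_D by (simp only: mult_ac)
    finally show ?thesis using N ref(1) by (intro exI[of _ "X 0"]) (simp add: R L_def)
  next
    case False
    then have l: "l = Suc k" using orders(2) by (simp add: k_def l_def)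
    have "X 0 ^ k * (X (2 * \<alpha>) ^ l * X \<alpha> ^ m) * R dvd
        (- X 0) ^ l * ((- X (2 * \<alpha>)) ^ Suc k * (- X \<alpha>) ^ m) * reflect \<alpha> R"
      using l dvd_R by (intro mult_dvd_mono power_dvd_minus_power) auto
    also have "\<dots> = (- X (2 * \<alpha>)) * reflect \<alpha> D" unfolding ref_D power_Suc by (simp only: mult_ac)
    finally have "D dvd reflect \<alpha> (X 0) * reflect \<alpha> D" unfolding ref(1) by (simp only: R L_def)
    moreover have "reflect \<alpha> (X 0) * reflect \<alpha> (reflect \<alpha> (X 0)) = [:0, 1:] * [:2 * \<alpha>, - 1:]"
      using N by (simp only: reflect_reflect) (simp only: ref(1) mult.commute)
    ultimately show ?thesis by blast
  qed
qed

text \<open>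
  Both conditions speak about separate parts of the space, but a single cyclic decomposition of the
  whole space serves both: the intertwining controls the orders of each invariant factor, and its
  rootless part is constant or an elementary factor on the rootless space.
\<close>

lemma exists_reflection:
  assumes "\<alpha> \<noteq> 0" "(2 :: 'a) \<noteq> 0"
    and intertwined: "intertwined (n_seq scale u 0) (n_seq scale u (2 * \<alpha>))"
    and factors: "\<forall>P \<in> set (elementary_factors scale (rootless_space scale u {0, \<alpha>, 2 * \<alpha>}) u). reflect \<alpha> P = P"
  shows "\<exists>b. Vector_Spaces.linear scale scale b \<and>
    (\<forall>x. b (u x) = (2 * \<alpha>) *s b x - u (b x)) \<and> (\<forall>x. b (b x) = (2 * \<alpha>) *s u x - u (u x))"
proof -
  define \<Lambda> where "\<Lambda> = {0, \<alpha>, 2 * \<alpha>}"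
  define Q where "Q = rootless_part \<Lambda> (min_poly scale u)"
  define W where "W = rootless_space scale u \<Lambda>"
  define Es where "Es = rev (elementary_factors scale W u)"
  note Es = elementary_factors_cyclic_decomp[OF stable_rootless_space[of \<Lambda>], folded W_def, folded Es_def]
  have Q_root: "poly Q c \<noteq> 0" if "c \<in> \<Lambda>" for c using rootless_part_nonroot that by (simp add: Q_def)
  obtain Ds where Ds: "cyclic_decomp UNIV Ds" "sorted_wrt (\<lambda>P Q. Q dvd P) Ds" "\<forall>P\<in>set Ds. lead_coeff P = 1 \<and> degree P > 0"
    using cyclic_decomp_exists[OF stable_UNIV] by blast
  have Ds_nz: "D \<noteq> 0" if "D \<in> set Ds" for D using Ds(3) that by auto
  \<comment> \<open>The elementary factors on the rootless space are the nonconstant rootless parts of the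
    invariant factors of \<open>u\<close>.\<close>
  define Fs where "Fs = filter (\<lambda>F. degree F > 0) (map (\<lambda>D. pgcd D Q) Ds)"
  have "Fs = Es"
  proof (rule divisor_chain_unique)
    have "pgcd A Q dvd pgcd B Q" if "A dvd B" for A B
      using that by (simp add: dvd_pgcd_iff) (metis dvd_trans pgcd_dvd(1))
    then show "sorted_wrt (\<lambda>P Q. Q dvd P) Fs"
      unfolding Fs_def using Ds(2) by (intro sorted_wrt_filter) (auto simp: sorted_wrt_map intro: sorted_wrt_mono_rel[rotated])
    show "\<forall>P\<in>set Fs. lead_coeff P = 1 \<and> degree P > 0" using Ds_nz pgcd_monic by (auto simp: Fs_def)
    show "\<forall>P\<in>set Es. lead_coeff P = 1 \<and> degree P > 0" using Es(3) by (simp add: Es_def)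
    fix R
    have "(\<Sum>F\<leftarrow>Fs. degree (pgcd F R)) = (\<Sum>D\<leftarrow>Ds. degree (pgcd (pgcd D Q) R))"
    proof -
      have "degree (pgcd F R) = 0" if "F \<noteq> 0" "degree F = 0" for F
        using dvd_imp_degree_le[OF pgcd_dvd(1)[of F R] that(1)] that(2) by simp
      moreover have "\<forall>D\<in>set Ds. pgcd D Q \<noteq> 0" using Ds_nz by auto
      ultimately show ?thesis unfolding Fs_def by (induction Ds) auto
    qed
    also have "\<dots> = (\<Sum>D\<leftarrow>Ds. degree (pgcd D (pgcd Q R)))"
    proof -
      have "degree (pgcd (pgcd D Q) R) = degree (pgcd D (pgcd Q R))" for D
        by (rule degree_pgcd_cong) (auto simp: dvd_pgcd_iff)
      then show ?thesis by simp
    qed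
    also have "\<dots> = dim {x \<in> UNIV. pgcd Q R \<star> x = 0}" by (rule cyclic_decomp_dim_kernel[OF Ds(1), symmetric])
    also have "{x \<in> UNIV. pgcd Q R \<star> x = 0} = {x \<in> W. R \<star> x = 0}"
      by (auto simp: act_pgcd_eq_0_iff W_def rootless_space_eq Q_def)
    also have "dim \<dots> = (\<Sum>E\<leftarrow>Es. degree (pgcd E R))" by (rule cyclic_decomp_dim_kernel[OF Es(1)])
    finally show "(\<Sum>F\<leftarrow>Fs. degree (pgcd F R)) = (\<Sum>E\<leftarrow>Es. degree (pgcd E R))" .
  qed (rule Es(2))
  have "\<forall>D\<in>set Ds. \<exists>g. g * reflect \<alpha> g = [:0, 1:] * [:2 * \<alpha>, - 1:] \<and> D dvd g * reflect \<alpha> D"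
  proof
    fix D assume D: "D \<in> set Ds"
    show "\<exists>g. g * reflect \<alpha> g = [:0, 1:] * [:2 * \<alpha>, - 1:] \<and> D dvd g * reflect \<alpha> D"
    proof (rule exists_twist[OF assms(1,2) Ds_nz[OF D], where B = "pgcd D Q"])
      show "order 0 D \<le> order (2 * \<alpha>) D + 1" "order (2 * \<alpha>) D \<le> order 0 D + 1"
        using intertwined order_le_of_n_seq[OF Ds _ D] unfolding intertwined_def by blast+
      show "pgcd D Q dvd D" by simp
      show "reflect \<alpha> (pgcd D Q) = pgcd D Q"
      proof (cases "degree (pgcd D Q) = 0")
        case True
        then show ?thesis by (elim degree_eq_zeroE) simp
      next
        case False
        then have "pgcd D Q \<in> set Fs" using D by (auto simp: Fs_def)
        then show ?thesis using factors \<open>Fs = Es\<close> by (simp add: Es_def W_def \<Lambda>_def)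
      qed
      show "poly (pgcd D Q) c \<noteq> 0" if "c \<in> {0, \<alpha>, 2 * \<alpha>}" for c
        using Q_root[of c] that pgcd_dvd(2)[of D Q] unfolding \<Lambda>_def by (metis dvd_trans poly_eq_0_iff_dvd)
      show "R dvd pgcd D Q" if "R dvd D" "\<And>c. c \<in> {0, \<alpha>, 2 * \<alpha>} \<Longrightarrow> poly R c \<noteq> 0" for R
      proof -
        have "D dvd min_poly scale u"
          using cyclic_decomp_dvd[OF Ds(1) D] min_poly(2)[of "min_poly scale u"] by simp
        then have "R dvd Q" unfolding Q_def \<Lambda>_def using that dvd_trans by (intro rootless_dvd) blast+
        then show ?thesis using that(1) by (simp add: dvd_pgcd_iff)
      qed
    qed
  qed
  from cyclic_decomp_reflection[OF Ds(1) this] obtain b where b: "\<forall>x y. b (x + y) = b x + b y"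
    "\<forall>c x. b (c *s x) = c *s b x" "\<forall>x. b (u x) = [:2 * \<alpha>, - 1:] \<star> b x"
    "\<forall>x. b (b x) = ([:0, 1:] * [:2 * \<alpha>, - 1:]) \<star> x"
    unfolding ball_UNIV by blast
  have "Vector_Spaces.linear scale scale b"
    using b(1,2) by (simp add: Vector_Spaces.linear_iff vector_space_axioms)
  moreover have "[:2 * \<alpha>, - 1:] \<star> x = (2 * \<alpha>) *s x - u x" for x by (simp add: act_pCons u.neg)
  moreover have "([:0, 1:] * [:2 * \<alpha>, - 1:]) \<star> x = (2 * \<alpha>) *s u x - u (u x)" for x
    unfolding act_mult by (simp add: act_pCons u.neg u.diff u.scale)
  ultimately show ?thesis using b(3,4) by (intro exI[of _ b]) simp
qed

end

section \<open>Sums of two idempotents with equal coefficients\<close>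

lemma two_neq_zero:
  assumes "CHAR('a::field) \<noteq> 2"
  shows "(2 :: 'a) \<noteq> 0"
proof
  assume "(2 :: 'a) = 0"
  then have "of_nat 2 = (0 :: 'a)" by simp
  then have "CHAR('a) dvd 2" by (simp only: of_nat_eq_0_iff_char_dvd)
  then have "CHAR('a) = 1" using assms by (metis prime_nat_iff two_is_prime_nat)
  then have "of_nat 1 = (0 :: 'a)" by (metis of_nat_CHAR)
  then show False by simp
qed

theorem theorem4:
  fixes scale :: "'a::field \<Rightarrow> 'b::ab_group_add \<Rightarrow> 'b"
    and Basis :: "'b set"
    and n :: nat
    and \<alpha> :: 'a
    and u :: "'b \<Rightarrow> 'b"
  assumes "CHAR('a) \<noteq> 2"
    and "\<alpha> \<noteq> 0"
    and "finite_dimensional_vector_space scale Basis"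
    and "vector_space.dim scale (UNIV :: 'b set) = n"
    and "n \<ge> 1"
    and "Vector_Spaces.linear scale scale u"
  shows "composite scale \<alpha> \<alpha> u \<longleftrightarrow>
    (intertwined (n_seq scale u 0) (n_seq scale u (2 * \<alpha>)) \<and>
     (\<forall>P \<in> set (elementary_factors scale
          (rootless_space scale u {0, \<alpha>, 2 * \<alpha>}) u).
        polynomial_of ([:- \<alpha>, 1:] ^ 2) P))"
proof -
  have two: "(2 :: 'a) \<noteq> 0" using assms(1) by (rule two_neq_zero)
  interpret endomorphism scale Basis u
    using assms(3,6) by (simp add: endomorphism_def endomorphism_axioms_def)
  show ?thesis
    unfolding composite_iff[OF assms(2) two] polynomial_of_iff_reflect[OF two]
  proof (intro iffI)
    assume "\<exists>b. Vector_Spaces.linear scale scale b \<and>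
      (\<forall>x. b (u x) = scale (2 * \<alpha>) (b x) - u (b x)) \<and> (\<forall>x. b (b x) = scale (2 * \<alpha>) (u x) - u (u x))"
    then obtain b where b: "Vector_Spaces.linear scale scale b"
      "\<And>x. b (u x) = scale (2 * \<alpha>) (b x) - u (b x)" "\<And>x. b (b x) = scale (2 * \<alpha>) (u x) - u (u x)"
      by blast
    have "2 * \<alpha> \<noteq> 0" using assms(2) two by simp
    interpret reflected_endomorphism scale Basis u \<alpha> b
      by (intro reflected_endomorphism.intro endomorphism_axioms reflected_endomorphism_axioms.intro b \<open>2 * \<alpha> \<noteq> 0\<close>)
    show "intertwined (n_seq scale u 0) (n_seq scale u (2 * \<alpha>)) \<and>
      (\<forall>P\<in>set (elementary_factors scale (rootless_space scale u {0, \<alpha>, 2 * \<alpha>}) u). reflect \<alpha> P = P)"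
      using n_seq_le elementary_factors_reflect by (simp add: intertwined_def)
  next
    assume "intertwined (n_seq scale u 0) (n_seq scale u (2 * \<alpha>)) \<and>
      (\<forall>P\<in>set (elementary_factors scale (rootless_space scale u {0, \<alpha>, 2 * \<alpha>}) u). reflect \<alpha> P = P)"
    then show "\<exists>b. Vector_Spaces.linear scale scale b \<and>
      (\<forall>x. b (u x) = scale (2 * \<alpha>) (b x) - u (b x)) \<and> (\<forall>x. b (b x) = scale (2 * \<alpha>) (u x) - u (u x))"
      by (intro exists_reflection[OF assms(2) two]) simp_all
  qed
qed

end
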